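(* Let $g$ be a non-negative revenue function that is adaptive monotone and adaptive submodular with respect to the prior $p$, let the item costs satisfy $c_e\ge 0$ for all $e\in E$, and let $k\ge 1$ be an integer. Let $\pi^o\in\arg\max_{\pi\in\Omega}\, g_{avg}(\pi)-c_{avg}(\pi)$ be an optimal policy among the set $\Omega$ of all policies selecting at most $k$ items, and let $\pi^d$ be the Adaptive Distorted Greedy Policy. Then $$g_{avg}(\pi^d)-c_{avg}(\pi^d)\;\ge\;\Bigl(1-\frac1e\Bigr)g_{avg}(\pi^o)-c_{avg}(\pi^o).$$
   Context: Items and states. $E$ is a finite set of $n$ items and $O$ a set of states. A realization is a function $\phi:E\to O$ ($\phi(e)$ is the state of $e$). $\Phi$ is a random realization with known (discrete) prior distribution $p$, $p(\phi)=\Pr[\Phi=\phi]$. A partial realization $\psi$ is an assignment of states to the items of a subset $\mathrm{dom}(\psi)\subseteq E$; $\phi\sim\psi$ means $\phi$ agrees with $\psi$ on $\mathrm{dom}(\psi)$; $\psi\subseteq\psi'$ means $\mathrm{dom}(\psi)\subseteq\mathrm{dom}(\psi')$ and they agree on $\mathrm{dom}(\psi)$. Only partial realizations with $\Pr[\Phi\sim\psi]>0$ are considered. Revenue and cost. The revenue function assigns to $Y\subseteq E$ and a realization $\phi$ a number $g(Y,\phi)\ge 0$. Each item has a fixed cost $c_e\ge0$, and $c(Y)=\sum_{e\in Y}c_e$. Put $g(e\mid\psi)=\mathbb E[g(\mathrm{dom}(\psi)\cup\{e\},\Phi)-g(\mathrm{dom}(\psi),\Phi)\mid\Phi\sim\psi]$.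 $g$ is adaptive submodular if $g(e\mid\psi)\ge g(e\mid\psi')$ for all $\psi\subseteq\psi'$ and $e\in E\setminus\mathrm{dom}(\psi')$; it is adaptive monotone if $g(e\mid\psi)\ge0$ for all $\psi$ and $e\in E\setminus\mathrm{dom}(\psi)$. Policies. A (possibly randomized) policy $\pi$ sequentially selects items; the choice of the next item depends only on the partial realization observed so far (and internal randomness), and the state of an item is observed once it is selected. $E(\pi,\phi)$ is the (random) set of items selected by $\pi$ under $\phi$; $g_{avg}(\pi)=\mathbb E[g(E(\pi,\Phi),\Phi)]$ and $c_{avg}(\pi)=\mathbb E[c(E(\pi,\Phi))]$, the expectations being over $\Phi\sim p$ and the randomness of $\pi$. The policy $\pi^d$. Add a dummy item $d$ with $c_d=0$ and $g(d\mid\psi)=0$ for all $\psi$ (selecting $d$ has no effect on revenue or cost), and let $E'=E\cup\{d\}$. For $i\in\{0,\dots,k-1\}$ let $H_i(\psi,e)=(1-\frac1k)^{k-(i+1)}g(e\mid\psi)-c_e$ (with $0^0=1$). Start with $\psi_0=\emptyset$. For $i=0,1,\dots,k-1$: choose $e_i\in\arg\max_{e\in E'}H_i(\psi_i,e)$ (ties broken arbitrarily; items already in $\mathrm{dom}(\psi_i)$ are allowed, and re-selecting one changes nothing and incurs no further cost), observe the state of $e_i$, and set $\psi_{i+1}=\psi_i\cup\{\phi(e_i)\}$. The selected set is $\{e_0,\dots,e_{k-1}\}$ (dummy removed). *)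

theory Defs
  imports "HOL-Probability.Probability"
begin

text \<open>
  Items are the elements of a finite set \<open>E\<close>, states those of a set \<open>S\<close>, and realizations are the
  elements of \<open>E \<rightarrow>\<^sub>E S\<close>. The prior is a \<open>pmf\<close> on realizations; its support may be countably infinite.
  Partial realizations are maps, and the relation of one extending another is \<open>\<subseteq>\<^sub>m\<close>.
\<close>

type_synonym ('e, 'o) realization = "'e \<Rightarrow> 'o"
type_synonym ('e, 'o) partial_realization = "'e \<rightharpoonup> 'o"

definition agrees :: "('e, 'o) realization \<Rightarrow> ('e, 'o) partial_realization \<Rightarrow> bool" where
  "agrees \<phi> \<psi> \<longleftrightarrow> (\<forall>e\<in>dom \<psi>. \<psi> e = Some (\<phi> e))"

definition partial_realizations ::
    "'e set \<Rightarrow> ('e, 'o) realization pmf \<Rightarrow> ('e, 'o) partial_realization set" where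
  "partial_realizations E p =
     {\<psi>. dom \<psi> \<subseteq> E \<and> measure_pmf.prob p {\<phi>. agrees \<phi> \<psi>} > 0}"

definition marginal ::
    "('e, 'o) realization pmf \<Rightarrow> ('e set \<Rightarrow> ('e, 'o) realization \<Rightarrow> real)
      \<Rightarrow> 'e \<Rightarrow> ('e, 'o) partial_realization \<Rightarrow> real" where
  "marginal p g e \<psi> =
     measure_pmf.expectation (cond_pmf p {\<phi>. agrees \<phi> \<psi>})
       (\<lambda>\<phi>. g (dom \<psi> \<union> {e}) \<phi> - g (dom \<psi>) \<phi>)"

definition adaptive_submodular ::
    "'e set \<Rightarrow> ('e, 'o) realization pmf \<Rightarrow> ('e set \<Rightarrow> ('e, 'o) realization \<Rightarrow> real) \<Rightarrow> bool" where
  "adaptive_submodular E p g \<longleftrightarrow>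
     (\<forall>\<psi>\<in>partial_realizations E p. \<forall>\<psi>'\<in>partial_realizations E p. \<psi> \<subseteq>\<^sub>m \<psi>' \<longrightarrow>
        (\<forall>e\<in>E - dom \<psi>'. marginal p g e \<psi> \<ge> marginal p g e \<psi>'))"

definition adaptive_monotone ::
    "'e set \<Rightarrow> ('e, 'o) realization pmf \<Rightarrow> ('e set \<Rightarrow> ('e, 'o) realization \<Rightarrow> real) \<Rightarrow> bool" where
  "adaptive_monotone E p g \<longleftrightarrow>
     (\<forall>\<psi>\<in>partial_realizations E p. \<forall>e\<in>E - dom \<psi>. marginal p g e \<psi> \<ge> 0)"

text \<open>
  A randomized policy sends the partial realization observed so far to the distribution of its next
  action: \<open>Some e\<close> selects the item \<open>e\<close>, \<open>None\<close> stops. Only items not selected before are chosen,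
  so every execution stops after at most \<open>card E\<close> selections.
\<close>

type_synonym ('e, 'o) policy = "('e, 'o) partial_realization \<Rightarrow> 'e option pmf"

definition is_policy :: "'e set \<Rightarrow> ('e, 'o) realization pmf \<Rightarrow> ('e, 'o) policy \<Rightarrow> bool" where
  "is_policy E p \<pi> \<longleftrightarrow>
     (\<forall>\<psi>\<in>partial_realizations E p. set_pmf (\<pi> \<psi>) \<subseteq> insert None (Some ` (E - dom \<psi>)))"

primrec policy_run ::
    "nat \<Rightarrow> ('e, 'o) policy \<Rightarrow> ('e, 'o) realization \<Rightarrow> ('e, 'o) partial_realization
      \<Rightarrow> ('e, 'o) partial_realization pmf" where
  "policy_run 0 \<pi> \<phi> \<psi> = return_pmf \<psi>"
| "policy_run (Suc n) \<pi> \<phi> \<psi> =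
     bind_pmf (\<pi> \<psi>) (\<lambda>x. case x of
         None \<Rightarrow> return_pmf \<psi>
       | Some e \<Rightarrow> policy_run n \<pi> \<phi> (\<psi>(e \<mapsto> \<phi> e)))"

definition selected :: "'e set \<Rightarrow> ('e, 'o) policy \<Rightarrow> ('e, 'o) realization \<Rightarrow> 'e set pmf" where
  "selected E \<pi> \<phi> = map_pmf dom (policy_run (card E) \<pi> \<phi> Map.empty)"

definition policies_at_most ::
    "'e set \<Rightarrow> ('e, 'o) realization pmf \<Rightarrow> nat \<Rightarrow> ('e, 'o) policy set" where
  "policies_at_most E p k =
     {\<pi>. is_policy E p \<pi> \<and> (\<forall>\<phi>\<in>set_pmf p. \<forall>Y\<in>set_pmf (selected E \<pi> \<phi>). card Y \<le> k)}"

text \<open>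
  In \<open>g_avg\<close> and \<open>c_avg\<close> the last argument gives, for each realization, the distribution of the
  selected set: the outer expectation is over the prior, the inner one over the internal randomness.
\<close>

definition g_avg ::
    "('e, 'o) realization pmf \<Rightarrow> ('e set \<Rightarrow> ('e, 'o) realization \<Rightarrow> real)
      \<Rightarrow> (('e, 'o) realization \<Rightarrow> 'e set pmf) \<Rightarrow> real" where
  "g_avg p g sel =
     measure_pmf.expectation p (\<lambda>\<phi>. measure_pmf.expectation (sel \<phi>) (\<lambda>Y. g Y \<phi>))"

definition c_avg ::
    "('e, 'o) realization pmf \<Rightarrow> ('e \<Rightarrow> real)
      \<Rightarrow> (('e, 'o) realization \<Rightarrow> 'e set pmf) \<Rightarrow> real" where
  "c_avg p c sel =
     measure_pmf.expectation p (\<lambda>\<phi>. measure_pmf.expectation (sel \<phi>) (\<lambda>Y. \<Sum>e\<in>Y. c e))"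

text \<open>
  In the greedy policy \<open>None\<close> is the dummy item, which has zero marginal revenue and zero cost.
\<close>

definition marginal_dummy ::
    "('e, 'o) realization pmf \<Rightarrow> ('e set \<Rightarrow> ('e, 'o) realization \<Rightarrow> real)
      \<Rightarrow> 'e option \<Rightarrow> ('e, 'o) partial_realization \<Rightarrow> real" where
  "marginal_dummy p g x \<psi> = (case x of None \<Rightarrow> 0 | Some e \<Rightarrow> marginal p g e \<psi>)"

definition cost_dummy :: "('e \<Rightarrow> real) \<Rightarrow> 'e option \<Rightarrow> real" where
  "cost_dummy c x = (case x of None \<Rightarrow> 0 | Some e \<Rightarrow> c e)"

definition distorted_gain ::
    "('e, 'o) realization pmf \<Rightarrow> ('e set \<Rightarrow> ('e, 'o) realization \<Rightarrow> real) \<Rightarrow> ('e \<Rightarrow> real)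
      \<Rightarrow> nat \<Rightarrow> nat \<Rightarrow> ('e, 'o) partial_realization \<Rightarrow> 'e option \<Rightarrow> real" where
  "distorted_gain p g c k i \<psi> x =
     (1 - 1 / real k) ^ (k - (i + 1)) * marginal_dummy p g x \<psi> - cost_dummy c x"

text \<open>
  A greedy rule gives the distribution of the item selected in round \<open>i\<close> from the current partial
  realization. Ties between maximizers may be broken in any way, including at random. The round is a
  separate argument because it is not determined by the partial realization: selecting the dummy
  item or an item selected before uses up a round but leaves the partial realization unchanged.
\<close>

type_synonym ('e, 'o) greedy_rule = "nat \<Rightarrow> ('e, 'o) partial_realization \<Rightarrow> 'e option pmf"

definition is_distorted_greedy ::
    "'e set \<Rightarrow> ('e, 'o) realization pmf \<Rightarrow> ('e set \<Rightarrow> ('e, 'o) realization \<Rightarrow> real)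
      \<Rightarrow> ('e \<Rightarrow> real) \<Rightarrow> nat \<Rightarrow> ('e, 'o) greedy_rule \<Rightarrow> bool" where
  "is_distorted_greedy E p g c k \<pi> \<longleftrightarrow>
     (\<forall>i<k. \<forall>\<psi>\<in>partial_realizations E p. \<forall>x\<in>set_pmf (\<pi> i \<psi>).
        is_arg_max (distorted_gain p g c k i \<psi>) (\<lambda>y. y \<in> insert None (Some ` E)) x)"

primrec greedy_run ::
    "('e, 'o) greedy_rule \<Rightarrow> ('e, 'o) realization \<Rightarrow> nat \<Rightarrow> ('e, 'o) partial_realization pmf" where
  "greedy_run \<pi> \<phi> 0 = return_pmf Map.empty"
| "greedy_run \<pi> \<phi> (Suc i) =
     bind_pmf (greedy_run \<pi> \<phi> i) (\<lambda>\<psi>.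
       map_pmf (\<lambda>x. case x of None \<Rightarrow> \<psi> | Some e \<Rightarrow> \<psi>(e \<mapsto> \<phi> e)) (\<pi> i \<psi>))"

definition greedy_selected ::
    "nat \<Rightarrow> ('e, 'o) greedy_rule \<Rightarrow> ('e, 'o) realization \<Rightarrow> 'e set pmf" where
  "greedy_selected k \<pi> \<phi> = map_pmf dom (greedy_run \<pi> \<phi> k)"

end

theory Submission
  imports Defs
begin

text \<open>
  Let \<open>G\<^sub>i\<close> and \<open>C\<^sub>i\<close> be the expected revenue and cost after \<open>i\<close> greedy rounds and \<open>\<beta>\<^sub>i = (1 - 1/k)^(k-i)\<close>.
  The potential \<open>\<beta>\<^sub>i G\<^sub>i - C\<^sub>i\<close> grows in round \<open>i\<close> by at least the maximal distorted gain plus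
  \<open>\<beta>\<^sub>i\<^sub>+\<^sub>1 G\<^sub>i / k\<close>. Run the optimal policy after the greedy observations \<open>\<psi>\<close>: by adaptive submodularity
  each of its at most \<open>k\<close> items has distorted gain at most the maximum at \<open>\<psi>\<close>, and by adaptive monotonicity
  (applied to the greedy rounds that follow the optimal policy) the union earns at least as much as the
  optimal policy alone. Hence the potential grows by at least \<open>(\<beta>\<^sub>i\<^sub>+\<^sub>1 G\<^sub>o - C\<^sub>o) / k\<close>, and these
  bounds telescope to \<open>(1 - (1 - 1/k)^k) G\<^sub>o - C\<^sub>o\<close>.

  Both policies are run on the same realization \<open>\<phi>\<close>. What makes conditioning possible is that the
  probability of observing \<open>\<psi>\<close> is the same for all realizations that agree with \<open>\<psi>\<close>; therefore, given
  that a policy has observed \<open>\<psi>\<close>, the realization is distributed as the prior conditioned on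
  agreement with \<open>\<psi>\<close>.
\<close>

subsection \<open>Expectations over mass functions\<close>

text \<open>Tower rule for possibly unbounded integrands. For nonnegative ones it follows from the
  identity for nonnegative integrals, where finiteness of the total carries over to the inner
  integrals; the general case subtracts the negative part from the positive part.\<close>

lemma has_bochner_integral_bind_pmf:
  fixes f :: "'b \<Rightarrow> real"
  assumes "integrable (measure_pmf (bind_pmf M N)) f"
  shows "has_bochner_integral (measure_pmf M) (\<lambda>x. measure_pmf.expectation (N x) f)
           (measure_pmf.expectation (bind_pmf M N) f)"
proof -
  let ?B = "measure_pmf (bind_pmf M N)"
  have nonneg: "(\<forall>x\<in>set_pmf M. integrable (measure_pmf (N x)) h) \<and>
      has_bochner_integral (measure_pmf M) (\<lambda>x. measure_pmf.expectation (N x) h)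
        (measure_pmf.expectation (bind_pmf M N) h)"
    if h: "integrable ?B h" and pos: "\<And>x. h x \<ge> 0" for h :: "'b \<Rightarrow> real"
  proof -
    have eq: "(\<integral>\<^sup>+x. \<integral>\<^sup>+y. h y \<partial>N x \<partial>M) = ennreal (measure_pmf.expectation (bind_pmf M N) h)"
      using nn_integral_eq_integral[OF h] pos by simp
    \<comment> \<open>For a \<open>pmf\<close>, almost everywhere means at every point of the
      support, so each inner integral there is finite.\<close>
    have "AE x in M. (\<integral>\<^sup>+y. h y \<partial>N x) \<noteq> \<infinity>"
      by (rule nn_integral_PInf_AE) (use eq in auto)
    then have fin: "integrable (measure_pmf (N x)) h" if "x \<in> set_pmf M" for x
      using that pos by (intro integrableI_nonneg) (auto simp: AE_measure_pmf_iff top.not_eq_extremum)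
    have "(\<integral>\<^sup>+x. ennreal (measure_pmf.expectation (N x) h) \<partial>M) = (\<integral>\<^sup>+x. \<integral>\<^sup>+y. h y \<partial>N x \<partial>M)"
      by (rule nn_integral_cong_AE)
        (use fin pos in \<open>auto simp: AE_measure_pmf_iff intro!: nn_integral_eq_integral[symmetric]\<close>)
    with eq fin pos show ?thesis
      by (auto intro!: has_bochner_integral_nn_integral)
  qed
  define fp where "fp x = max 0 (f x)" for x
  define fm where "fm x = max 0 (- f x)" for x
  have f: "f = (\<lambda>x. fp x - fm x)"
    by (auto simp: fp_def fm_def)
  have ip: "integrable ?B fp" and im: "integrable ?B fm"
    unfolding fp_def fm_def using assms by auto
  have p: "(\<forall>x\<in>set_pmf M. integrable (measure_pmf (N x)) fp)"
      "has_bochner_integral (measure_pmf M) (\<lambda>x. measure_pmf.expectation (N x) fp)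
        (measure_pmf.expectation (bind_pmf M N) fp)"
    and m: "(\<forall>x\<in>set_pmf M. integrable (measure_pmf (N x)) fm)"
      "has_bochner_integral (measure_pmf M) (\<lambda>x. measure_pmf.expectation (N x) fm)
        (measure_pmf.expectation (bind_pmf M N) fm)"
    using nonneg[OF ip] nonneg[OF im] by (auto simp: fp_def fm_def)
  have "measure_pmf.expectation (bind_pmf M N) f =
      measure_pmf.expectation (bind_pmf M N) fp - measure_pmf.expectation (bind_pmf M N) fm"
    unfolding f using ip im by simp
  with has_bochner_integral_diff[OF p(2) m(2)]
  have "has_bochner_integral (measure_pmf M)
      (\<lambda>x. measure_pmf.expectation (N x) fp - measure_pmf.expectation (N x) fm)
      (measure_pmf.expectation (bind_pmf M N) f)"
    by simp
  \<comment> \<open>The inner integral is known to split into its two parts only on the support,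
    hence the almost-everywhere congruence.\<close>
  then show ?thesis
    by (rule has_bochner_integral_cong_AE[THEN iffD1, rotated -1])
      (use p(1) m(1) in \<open>auto simp: AE_measure_pmf_iff f\<close>)
qed

lemma integral_bind_pmf_integrable:
  fixes f :: "'b \<Rightarrow> real"
  assumes "integrable (measure_pmf (bind_pmf M N)) f"
  shows "measure_pmf.expectation (bind_pmf M N) f =
           measure_pmf.expectation M (\<lambda>x. measure_pmf.expectation (N x) f)"
  using has_bochner_integral_bind_pmf[OF assms] by (simp add: has_bochner_integral_iff)

lemma integral_cong_pmf:
  fixes f g :: "'a \<Rightarrow> real"
  assumes "\<And>x. x \<in> set_pmf M \<Longrightarrow> f x = g x"
  shows "measure_pmf.expectation M f = measure_pmf.expectation M g"
  using assms by (intro integral_cong_AE) (auto simp: AE_measure_pmf_iff)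

lemma integral_mono_pmf:
  fixes f g :: "'a \<Rightarrow> real"
  assumes "integrable (measure_pmf M) f" "integrable (measure_pmf M) g"
    and "\<And>x. x \<in> set_pmf M \<Longrightarrow> f x \<le> g x"
  shows "measure_pmf.expectation M f \<le> measure_pmf.expectation M g"
  using assms by (intro integral_mono_AE) (auto simp: AE_measure_pmf_iff)

lemma integrable_bound_pmf:
  fixes f :: "'a \<Rightarrow> real"
  assumes "integrable (measure_pmf M) B" and "\<And>x. x \<in> set_pmf M \<Longrightarrow> \<bar>f x\<bar> \<le> B x"
  shows "integrable (measure_pmf M) f"
  using assms(1) by (rule Bochner_Integration.integrable_bound)
    (use assms(2) in \<open>fastforce simp: AE_measure_pmf_iff\<close>)+

lemma abs_expectation_le:
  fixes f :: "'a \<Rightarrow> real"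
  assumes "\<And>x. x \<in> set_pmf M \<Longrightarrow> \<bar>f x\<bar> \<le> b"
  shows "\<bar>measure_pmf.expectation M f\<bar> \<le> b"
proof -
  have i: "integrable (measure_pmf M) f"
    by (rule integrable_bound_pmf[OF _ assms]) auto
  have "\<bar>measure_pmf.expectation M f\<bar> \<le> measure_pmf.expectation M (\<lambda>x. \<bar>f x\<bar>)"
    by (rule integral_abs_bound)
  also have "\<dots> \<le> measure_pmf.expectation M (\<lambda>x. b)"
    by (rule integral_mono_pmf) (use i assms in auto)
  finally show ?thesis by simp
qed

text \<open>Conditioning restricts to \<open>A\<close> and rescales, so it multiplies the integral
  of the absolute value by at most the finite factor 1 / Pr[\<open>A\<close>].\<close>

lemma integrable_cond_pmf:
  fixes f :: "'a \<Rightarrow> real"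
  assumes "integrable (measure_pmf M) f" and ne: "set_pmf M \<inter> A \<noteq> {}"
  shows "integrable (measure_pmf (cond_pmf M A)) f"
proof -
  have m: "emeasure (measure_pmf M) A \<noteq> 0"
    using ne by (simp add: measure_pmf.emeasure_eq_measure measure_pmf_zero_iff)
  have "(\<integral>\<^sup>+x. norm (f x) \<partial>cond_pmf M A) =
      (\<integral>\<^sup>+x. norm (f x) * indicator A x \<partial>M) / emeasure (measure_pmf M) A"
    unfolding cond_pmf.rep_eq[OF ne]
    by (simp add: nn_integral_uniform_measure ennreal_mult'' flip: ennreal_indicator)
  also have "(\<integral>\<^sup>+x. norm (f x) * indicator A x \<partial>M) \<le> (\<integral>\<^sup>+x. norm (f x) \<partial>M)"
    by (intro nn_integral_mono) (auto simp: indicator_def)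
  then have "(\<integral>\<^sup>+x. norm (f x) * indicator A x \<partial>M) / emeasure (measure_pmf M) A < \<infinity>"
    using assms(1) m by (auto simp: integrable_iff_bounded ennreal_divide_eq_top_iff less_top[symmetric] top_unique)
  finally show ?thesis
    by (simp add: integrable_iff_bounded)
qed

text \<open>The normalizing constant Pr[\<open>A\<close>] of the inner conditioning cancels.\<close>

lemma cond_cond_pmf:
  assumes "set_pmf M \<inter> (A \<inter> B) \<noteq> {}"
  shows "cond_pmf (cond_pmf M A) B = cond_pmf M (A \<inter> B)"
proof -
  have A: "set_pmf M \<inter> A \<noteq> {}"
    using assms by auto
  then have AB: "set_pmf (cond_pmf M A) \<inter> B \<noteq> {}"
    using assms by (simp add: set_cond_pmf Int_assoc)
  have pos: "measure_pmf.prob M A > 0"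
    using A by (simp add: measure_pmf_zero_iff zero_less_measure_iff)
  have "measure_pmf.prob (cond_pmf M A) B = measure_pmf.prob M (A \<inter> B) / measure_pmf.prob M A"
    unfolding cond_pmf.rep_eq[OF A]
    by (rule measure_uniform_measure)
      (use A in \<open>auto simp: measure_pmf.emeasure_eq_measure measure_pmf_zero_iff\<close>)
  then show ?thesis
    using pos by (intro pmf_eqI) (auto simp: pmf_cond[OF AB] pmf_cond[OF A] pmf_cond[OF assms])
qed

text \<open>The coupling of a realization with what is observed on it. Keeping both coordinates
  allows integrands that depend on both, and disintegration along either one.\<close>

definition joint :: "'a pmf \<Rightarrow> ('a \<Rightarrow> 'b pmf) \<Rightarrow> ('a \<times> 'b) pmf" where
  "joint q K = bind_pmf q (\<lambda>x. map_pmf (Pair x) (K x))"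

lemma set_joint: "set_pmf (joint q K) = {(x, y). x \<in> set_pmf q \<and> y \<in> set_pmf (K x)}"
  by (auto simp: joint_def)

lemma pmf_joint: "pmf (joint q K) (x, y) = pmf q x * pmf (K x) y"
proof -
  have "pmf (map_pmf (Pair z) (K z)) (x, y) = pmf (K x) y * indicator {x} z" for z
    by (cases "z = x") (auto simp: pmf_map_inj' inj_def pmf_eq_0_set_pmf)
  then show ?thesis
    by (simp add: joint_def pmf_bind measure_pmf_single)
qed

lemma map_fst_joint: "map_pmf fst (joint q K) = q"
  by (simp add: joint_def map_bind_pmf map_pmf_comp bind_return_pmf')

text \<open>The first marginal is \<open>q\<close>, so a majorant depending on the first coordinate
  alone keeps its integrability.\<close>

lemma integrable_joint:
  fixes f :: "'a \<times> 'b \<Rightarrow> real"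
  assumes "integrable (measure_pmf q) B"
    and "\<And>x y. x \<in> set_pmf q \<Longrightarrow> y \<in> set_pmf (K x) \<Longrightarrow> \<bar>f (x, y)\<bar> \<le> B x"
  shows "integrable (measure_pmf (joint q K)) f"
proof (rule integrable_bound_pmf)
  have "integrable (measure_pmf (map_pmf fst (joint q K))) B"
    using assms(1) by (simp add: map_fst_joint)
  then show "integrable (measure_pmf (joint q K)) (\<lambda>z. B (fst z))"
    by (simp only: integrable_map_pmf_eq)
qed (use assms(2) in \<open>auto simp: set_joint\<close>)

lemma integral_joint:
  fixes f :: "'a \<times> 'b \<Rightarrow> real"
  assumes "integrable (measure_pmf (joint q K)) f"
  shows "measure_pmf.expectation (joint q K) f =
           measure_pmf.expectation q (\<lambda>x. measure_pmf.expectation (K x) (\<lambda>y. f (x, y)))"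
  using integral_bind_pmf_integrable[OF assms[unfolded joint_def]] by (simp add: joint_def)

lemma integrable_expectation:
  fixes f :: "'a \<Rightarrow> 'b \<Rightarrow> real"
  assumes "integrable (measure_pmf q) B"
    and "\<And>x y. x \<in> set_pmf q \<Longrightarrow> y \<in> set_pmf (K x) \<Longrightarrow> \<bar>f x y\<bar> \<le> B x"
  shows "integrable (measure_pmf q) (\<lambda>x. measure_pmf.expectation (K x) (f x))"
  using assms by (intro integrable_bound_pmf[OF assms(1)] abs_expectation_le) auto

text \<open>Fubini: since \<open>N\<close> does not depend on \<open>x\<close>, the joint
  distribution is a product and can be generated in either order.\<close>

lemma integral_swap_pmf:
  fixes f :: "'a \<Rightarrow> 'b \<Rightarrow> real"
  assumes "integrable (measure_pmf q) B"
    and "\<And>x y. x \<in> set_pmf q \<Longrightarrow> y \<in> set_pmf N \<Longrightarrow> \<bar>f x y\<bar> \<le> B x"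
  shows "measure_pmf.expectation q (\<lambda>x. measure_pmf.expectation N (f x)) =
           measure_pmf.expectation N (\<lambda>y. measure_pmf.expectation q (\<lambda>x. f x y))"
proof -
  let ?J = "joint q (\<lambda>_. N)"
  let ?f = "\<lambda>(x, y). f x y"
  have J: "?J = bind_pmf N (\<lambda>y. map_pmf (\<lambda>x. (x, y)) q)"
    by (simp add: joint_def map_pmf_def bind_commute_pmf[of q])
  have i: "integrable (measure_pmf ?J) ?f"
    by (rule integrable_joint[OF assms(1)]) (use assms(2) in auto)
  show ?thesis
    using integral_joint[OF i] integral_bind_pmf_integrable[OF i[unfolded J]] by (simp add: J)
qed

subsection \<open>Nonanticipating observations\<close>

abbreviation posterior ::
    "('e, 'o) realization pmf \<Rightarrow> ('e, 'o) partial_realization \<Rightarrow> ('e, 'o) realization pmf" where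
  "posterior q \<psi> \<equiv> cond_pmf q {\<phi>. agrees \<phi> \<psi>}"

text \<open>The two clauses say that, on the support of \<open>q\<close>, the likelihood of \<psi>
  is a constant times the indicator of agreement with \<psi>. This is what policy runs, greedy runs
  and single observations have in common.\<close>

definition nonanticipating ::
    "('e, 'o) realization pmf \<Rightarrow> (('e, 'o) realization \<Rightarrow> ('e, 'o) partial_realization pmf) \<Rightarrow> bool" where
  "nonanticipating q K \<longleftrightarrow>
     (\<forall>\<phi>\<in>set_pmf q. \<forall>\<psi>\<in>set_pmf (K \<phi>). agrees \<phi> \<psi>) \<and>
     (\<forall>\<phi>\<in>set_pmf q. \<forall>\<phi>'\<in>set_pmf q. \<forall>\<psi>. agrees \<phi> \<psi> \<longrightarrow> agrees \<phi>' \<psi> \<longrightarrow> pmf (K \<phi>) \<psi> = pmf (K \<phi>') \<psi>)"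

text \<open>Bayes' rule: the likelihood of \<psi> is constant on the realizations that agree with
  \<psi> and zero on the others, so having observed \<psi> conditions the prior on agreement and on
  nothing more.\<close>

lemma joint_nonanticipating:
  fixes q :: "('e, 'o) realization pmf"
  assumes "nonanticipating q K"
  shows "joint q K =
    bind_pmf (bind_pmf q K) (\<lambda>\<psi>. map_pmf (\<lambda>\<phi>. (\<phi>, \<psi>)) (posterior q \<psi>))"
proof (rule pmf_eqI, clarify)
  fix \<phi> :: "('e, 'o) realization" and \<psi> :: "('e, 'o) partial_realization"
  let ?A = "{\<phi>. agrees \<phi> \<psi>}"
  let ?C = "posterior q"
  have "pmf (map_pmf (\<lambda>\<phi>. (\<phi>, \<psi>')) (?C \<psi>')) (\<phi>, \<psi>) = pmf (?C \<psi>) \<phi> * indicator {\<psi>} \<psi>'" for \<psi>'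
    using pmf_map_inj'[of "\<lambda>\<phi>. (\<phi>, \<psi>')" "?C \<psi>'" \<phi>]
    by (cases "\<psi>' = \<psi>") (auto simp: inj_def pmf_eq_0_set_pmf)
  then have rhs: "pmf (bind_pmf (bind_pmf q K) (\<lambda>\<psi>. map_pmf (\<lambda>\<phi>. (\<phi>, \<psi>)) (?C \<psi>))) (\<phi>, \<psi>) =
      pmf (?C \<psi>) \<phi> * pmf (bind_pmf q K) \<psi>"
    unfolding pmf_bind[of "bind_pmf q K"] by (simp add: measure_pmf_single)
  have support: "agrees \<phi>' \<psi>" if "\<phi>' \<in> set_pmf q" "\<psi> \<in> set_pmf (K \<phi>')" for \<phi>'
    using assms that by (auto simp: nonanticipating_def)
  show "pmf (joint q K) (\<phi>, \<psi>) =
      pmf (bind_pmf (bind_pmf q K) (\<lambda>\<psi>. map_pmf (\<lambda>\<phi>. (\<phi>, \<psi>)) (?C \<psi>))) (\<phi>, \<psi>)"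
  proof (cases "\<exists>\<phi>0\<in>set_pmf q. agrees \<phi>0 \<psi>")
    case True
    then obtain \<phi>0 where \<phi>0: "\<phi>0 \<in> set_pmf q" "agrees \<phi>0 \<psi>"
      by blast
    then have ne: "set_pmf q \<inter> ?A \<noteq> {}"
      by auto
    have eq: "pmf (K \<phi>') \<psi> = pmf (K \<phi>0) \<psi> * indicator ?A \<phi>'" if "\<phi>' \<in> set_pmf q" for \<phi>'
    proof (cases "agrees \<phi>' \<psi>")
      case True
      then have "pmf (K \<phi>') \<psi> = pmf (K \<phi>0) \<psi>"
        using assms \<phi>0 that unfolding nonanticipating_def by blast
      then show ?thesis
        using True by simp
    next
      case False
      then show ?thesis
        using support[OF that] by (auto simp: pmf_eq_0_set_pmf)
    qed
    \<comment> \<open>The marginal probability of \<psi> contains the probability of agreement as a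
      factor, which cancels the denominator of the posterior.\<close>
    have "pmf (bind_pmf q K) \<psi> = measure_pmf.expectation q (\<lambda>\<phi>'. pmf (K \<phi>0) \<psi> * indicator ?A \<phi>')"
      unfolding pmf_bind by (rule integral_cong_pmf) (rule eq)
    also have "\<dots> = pmf (K \<phi>0) \<psi> * measure_pmf.prob q ?A"
      by simp
    finally have b: "pmf (bind_pmf q K) \<psi> = pmf (K \<phi>0) \<psi> * measure_pmf.prob q ?A" .
    have "measure_pmf.prob q ?A \<noteq> 0"
      using ne by (simp add: measure_pmf_zero_iff)
    then have "pmf (?C \<psi>) \<phi> * pmf (bind_pmf q K) \<psi> =
        pmf q \<phi> * (pmf (K \<phi>0) \<psi> * indicator ?A \<phi>)"
      by (simp add: b pmf_cond[OF ne])
    also have "\<dots> = pmf q \<phi> * pmf (K \<phi>) \<psi>"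
      using eq[of \<phi>] by (cases "\<phi> \<in> set_pmf q") (auto simp: pmf_eq_0_set_pmf)
    finally show ?thesis
      by (simp only: rhs pmf_joint)
  next
    \<comment> \<open>The posterior would condition on a null event here; its value does not matter
      because \<psi> has probability zero.\<close>
    case False
    then have "pmf (bind_pmf q K) \<psi> = 0" and "pmf q \<phi> * pmf (K \<phi>) \<psi> = 0"
      using support by (auto simp: pmf_eq_0_set_pmf)
    then show ?thesis
      by (simp add: rhs pmf_joint)
  qed
qed

text \<open>The tower rule over the observed \<psi>: it suffices to compare posterior expectations
  for each reachable \<psi>. The global inequalities below are reduced in this way to statements
  about one partial realization.\<close>

lemma nonanticipating_integral_mono:
  fixes f1 f2 :: "('e, 'o) realization \<times> ('e, 'o) partial_realization \<Rightarrow> real"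
  assumes K: "nonanticipating q K"
    and i1: "integrable (measure_pmf (joint q K)) f1"
    and i2: "integrable (measure_pmf (joint q K)) f2"
    and le: "\<And>\<phi> \<psi>. \<phi> \<in> set_pmf q \<Longrightarrow> \<psi> \<in> set_pmf (K \<phi>) \<Longrightarrow>
        measure_pmf.expectation (posterior q \<psi>) (\<lambda>\<phi>. f1 (\<phi>, \<psi>)) \<le>
        measure_pmf.expectation (posterior q \<psi>) (\<lambda>\<phi>. f2 (\<phi>, \<psi>))"
  shows "measure_pmf.expectation (joint q K) f1 \<le> measure_pmf.expectation (joint q K) f2"
proof -
  note J = joint_nonanticipating[OF K]
  note h1 = has_bochner_integral_bind_pmf[OF i1[unfolded J], folded J]
    and h2 = has_bochner_integral_bind_pmf[OF i2[unfolded J], folded J]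
  show ?thesis
    unfolding has_bochner_integral_integral_eq[OF h1, symmetric]
      has_bochner_integral_integral_eq[OF h2, symmetric]
    by (rule integral_mono_pmf)
      (use h1 h2 le in \<open>auto simp: has_bochner_integral_iff\<close>)
qed

section \<open>Agreement, unions of partial realizations, and posteriors\<close>

lemma agrees_empty [simp]: "agrees \<phi> Map.empty"
  by (simp add: agrees_def)

lemma agrees_upd: "agrees \<phi> \<psi> \<Longrightarrow> agrees \<phi> (\<psi>(e \<mapsto> \<phi> e))"
  by (auto simp: agrees_def)

lemma agrees_map_le: "agrees \<phi> \<psi>' \<Longrightarrow> \<psi> \<subseteq>\<^sub>m \<psi>' \<Longrightarrow> agrees \<phi> \<psi>"
  by (auto simp: agrees_def map_le_def dom_def)

lemma agrees_eq:
  "agrees \<phi> \<psi> \<Longrightarrow> agrees \<phi>' \<psi> \<Longrightarrow> e \<in> dom \<psi> \<Longrightarrow> \<phi> e = \<phi>' e"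
  by (auto simp: agrees_def)

lemma map_le_upd_agrees: "agrees \<phi> \<psi> \<Longrightarrow> \<psi> \<subseteq>\<^sub>m \<psi>(e \<mapsto> \<phi> e)"
  by (auto simp: agrees_def map_le_def dom_def)

lemma map_add_commute_agrees:
  assumes "agrees \<phi> \<psi>" "agrees \<phi> \<omega>"
  shows "\<psi> ++ \<omega> = \<omega> ++ \<psi>"
  using assms by (fastforce simp: agrees_def map_add_def fun_eq_iff dom_def split: option.splits)

text \<open>The common witness \<open>\<phi>0\<close> makes \<psi> and \<omega> compatible; without
  compatibility \<open>++\<close> could overwrite values of \<psi>.\<close>

lemma agrees_map_add_iff:
  assumes "agrees \<phi>0 \<psi>" "agrees \<phi>0 \<omega>"
  shows "agrees \<phi> (\<psi> ++ \<omega>) \<longleftrightarrow> agrees \<phi> \<psi> \<and> agrees \<phi> \<omega>"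
proof -
  have "\<psi> \<subseteq>\<^sub>m \<psi> ++ \<omega>"
    using map_add_commute_agrees[OF assms] by simp
  moreover have "\<omega> \<subseteq>\<^sub>m \<psi> ++ \<omega>"
    by simp
  moreover have "agrees \<phi> (\<psi> ++ \<omega>)" if "agrees \<phi> \<psi>" "agrees \<phi> \<omega>"
    using that by (auto simp: agrees_def map_add_def dom_def split: option.splits)
  ultimately show ?thesis
    using agrees_map_le by blast
qed

lemma partial_realizations_iff:
  "\<psi> \<in> partial_realizations E p \<longleftrightarrow> dom \<psi> \<subseteq> E \<and> (\<exists>\<phi>\<in>set_pmf p. agrees \<phi> \<psi>)"
  using measure_pmf_zero_iff[of p "{\<phi>. agrees \<phi> \<psi>}"]
  by (auto simp: partial_realizations_def zero_less_measure_iff)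

lemma set_posterior:
  "\<psi> \<in> partial_realizations E q \<Longrightarrow> set_pmf (posterior q \<psi>) = {\<phi>\<in>set_pmf q. agrees \<phi> \<psi>}"
  by (subst set_cond_pmf) (auto simp: partial_realizations_iff)

lemma integrable_posterior:
  fixes f :: "('e, 'o) realization \<Rightarrow> real"
  shows "integrable (measure_pmf q) f \<Longrightarrow> \<psi> \<in> partial_realizations E q \<Longrightarrow>
    integrable (measure_pmf (posterior q \<psi>)) f"
  by (rule integrable_cond_pmf) (auto simp: partial_realizations_iff)

lemma posterior_empty: "posterior q Map.empty = q"
proof -
  have "set_pmf q \<inter> {\<phi>. agrees \<phi> Map.empty} \<noteq> {}"
    by (simp add: set_pmf_not_empty)
  then show ?thesis
    by (intro pmf_eqI) (simp add: pmf_cond)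
qed

text \<open>This turns conditioning in two stages into conditioning \<open>p\<close> once, the form
  in which adaptive monotonicity and submodularity are stated.\<close>

lemma posterior_posterior:
  assumes "\<phi> \<in> set_pmf q" "agrees \<phi> \<psi>" "agrees \<phi> \<omega>"
  shows "posterior (posterior q \<psi>) \<omega> = posterior q (\<psi> ++ \<omega>)"
proof -
  have "{\<phi>. agrees \<phi> \<psi>} \<inter> {\<phi>. agrees \<phi> \<omega>} = {\<phi>. agrees \<phi> (\<psi> ++ \<omega>)}"
    using agrees_map_add_iff[OF assms(2,3)] by auto
  then show ?thesis
    using assms by (subst cond_cond_pmf) auto
qed

section \<open>Runs of an arbitrary policy\<close>

lemma is_policy_mono: "is_policy E p \<pi> \<Longrightarrow> set_pmf q \<subseteq> set_pmf p \<Longrightarrow> is_policy E q \<pi>"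
  unfolding is_policy_def by (meson partial_realizations_iff subset_eq)

lemma policy_run_support:
  assumes "is_policy E p \<pi>" "\<phi> \<in> set_pmf p"
  shows "agrees \<phi> \<psi> \<Longrightarrow> dom \<psi> \<subseteq> E \<Longrightarrow> \<omega> \<in> set_pmf (policy_run n \<pi> \<phi> \<psi>) \<Longrightarrow>
    agrees \<phi> \<omega> \<and> dom \<omega> \<subseteq> E \<and> \<psi> \<subseteq>\<^sub>m \<omega>"
proof (induction n arbitrary: \<psi>)
  case (Suc n)
  then obtain x where x: "x \<in> set_pmf (\<pi> \<psi>)"
    and \<omega>: "\<omega> \<in> set_pmf (case x of None \<Rightarrow> return_pmf \<psi> | Some e \<Rightarrow> policy_run n \<pi> \<phi> (\<psi>(e \<mapsto> \<phi> e)))"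
    by auto
  show ?case
  proof (cases x)
    case None
    then show ?thesis using \<omega> Suc.prems by simp
  next
    case (Some e)
    have "\<psi> \<in> partial_realizations E p"
      using Suc.prems assms by (auto simp: partial_realizations_iff)
    then have "e \<in> E"
      using assms(1) x Some by (fastforce simp: is_policy_def)
    then have dom: "dom (\<psi>(e \<mapsto> \<phi> e)) \<subseteq> E"
      using Suc.prems by simp
    have "\<omega> \<in> set_pmf (policy_run n \<pi> \<phi> (\<psi>(e \<mapsto> \<phi> e)))"
      using \<omega> Some by simp
    then have "agrees \<phi> \<omega> \<and> dom \<omega> \<subseteq> E \<and> \<psi>(e \<mapsto> \<phi> e) \<subseteq>\<^sub>m \<omega>"
      by (rule Suc.IH[OF agrees_upd[OF Suc.prems(1)] dom])
    then show ?thesis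
      using map_le_upd_agrees[OF Suc.prems(1)] map_le_trans by blast
  qed
qed simp

text \<open>Consider the next item \<open>e\<close>. If \<omega> contains it, both realizations show
  the same state and the induction hypothesis applies. If not, neither run can end in \<omega>,
  since runs only extend what was observed.\<close>

lemma pmf_policy_run_eq:
  assumes "is_policy E p \<pi>" "\<phi> \<in> set_pmf p" "\<phi>' \<in> set_pmf p" "agrees \<phi> \<omega>" "agrees \<phi>' \<omega>"
  shows "agrees \<phi> \<psi> \<Longrightarrow> agrees \<phi>' \<psi> \<Longrightarrow> dom \<psi> \<subseteq> E \<Longrightarrow>
    pmf (policy_run n \<pi> \<phi> \<psi>) \<omega> = pmf (policy_run n \<pi> \<phi>' \<psi>) \<omega>"
proof (induction n arbitrary: \<psi>)
  case (Suc n)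
  have \<psi>: "\<psi> \<in> partial_realizations E p"
    using Suc.prems assms by (auto simp: partial_realizations_iff)
  have "pmf (policy_run n \<pi> \<phi> (\<psi>(e \<mapsto> \<phi> e))) \<omega> = pmf (policy_run n \<pi> \<phi>' (\<psi>(e \<mapsto> \<phi>' e))) \<omega>"
    if "Some e \<in> set_pmf (\<pi> \<psi>)" for e
  proof -
    have e: "e \<in> E"
      using assms(1) \<psi> that by (fastforce simp: is_policy_def)
    show ?thesis
    proof (cases "e \<in> dom \<omega>")
      case True
      then have eq: "\<phi>' e = \<phi> e"
        by (rule agrees_eq[OF assms(5,4)])
      have "dom (\<psi>(e \<mapsto> \<phi> e)) \<subseteq> E"
        using Suc.prems e by simp
      then show ?thesis
        unfolding eq
        by (rule Suc.IH[OF agrees_upd[OF Suc.prems(1)] agrees_upd[OF Suc.prems(2), of e, unfolded eq]])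
    next
      case False
      have "\<omega> \<notin> set_pmf (policy_run n \<pi> \<theta> (\<psi>(e \<mapsto> \<theta> e)))"
        if "\<theta> \<in> set_pmf p" "agrees \<theta> \<psi>" for \<theta>
        using policy_run_support[OF assms(1) that(1) agrees_upd[OF that(2)], of e \<omega> n]
          map_le_implies_dom_le[of "\<psi>(e \<mapsto> \<theta> e)" \<omega>] Suc.prems e False by auto
      from this[OF assms(2) Suc.prems(1)] this[OF assms(3) Suc.prems(2)] show ?thesis
        by (simp only: set_pmf_iff not_not)
    qed
  qed
  then show ?case
    unfolding policy_run.simps pmf_bind by (intro integral_cong_pmf) (auto split: option.splits)
qed simp

lemma nonanticipating_policy_run:
  assumes "is_policy E p \<pi>"
  shows "nonanticipating p (\<lambda>\<phi>. policy_run n \<pi> \<phi> Map.empty)"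
  unfolding nonanticipating_def
proof (intro conjI ballI allI impI)
  fix \<phi> \<omega> assume "\<phi> \<in> set_pmf p" "\<omega> \<in> set_pmf (policy_run n \<pi> \<phi> Map.empty)"
  then show "agrees \<phi> \<omega>"
    using policy_run_support[OF assms _ agrees_empty] by simp
next
  fix \<phi> \<phi>' \<omega>
  assume "\<phi> \<in> set_pmf p" "\<phi>' \<in> set_pmf p" "agrees \<phi> \<omega>" "agrees \<phi>' \<omega>"
  from pmf_policy_run_eq[OF assms this agrees_empty agrees_empty]
  show "pmf (policy_run n \<pi> \<phi> Map.empty) \<omega> = pmf (policy_run n \<pi> \<phi>' Map.empty) \<omega>"
    by simp
qed

text \<open>The one-step case, used to condition on the state revealed by a single selection. The
  hypothesis makes the extended map agree with the realization.\<close>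

lemma nonanticipating_observe:
  assumes "\<And>\<phi>. \<phi> \<in> set_pmf q \<Longrightarrow> agrees \<phi> \<psi>"
  shows "nonanticipating q (\<lambda>\<phi>. return_pmf (\<psi>(e \<mapsto> \<phi> e)))"
proof -
  have eq: "\<psi>(e \<mapsto> \<phi> e) = \<omega> \<longleftrightarrow> \<psi>(e \<mapsto> \<phi>' e) = \<omega>" if "agrees \<phi> \<omega>" "agrees \<phi>' \<omega>" for \<phi> \<phi>' \<omega>
  proof (cases "e \<in> dom \<omega>")
    case True
    then show ?thesis
      using agrees_eq[OF that] by simp
  next
    case False
    have "\<psi>(e \<mapsto> s) \<noteq> \<omega>" for s
    proof
      assume "\<psi>(e \<mapsto> s) = \<omega>"
      then have "e \<in> dom \<omega>"
        by auto
      with False show False ..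
    qed
    then show ?thesis
      by simp
  qed
  show ?thesis
    unfolding nonanticipating_def
  proof (intro conjI ballI allI impI)
    show "agrees \<phi> \<omega>" if "\<phi> \<in> set_pmf q" "\<omega> \<in> set_pmf (return_pmf (\<psi>(e \<mapsto> \<phi> e)))" for \<phi> \<omega>
      using that(2) agrees_upd[OF assms[OF that(1)]] by simp
    show "pmf (return_pmf (\<psi>(e \<mapsto> \<phi> e))) \<omega> = pmf (return_pmf (\<psi>(e \<mapsto> \<phi>' e))) \<omega>"
      if "agrees \<phi> \<omega>" "agrees \<phi>' \<omega>" for \<phi> \<phi>' \<omega>
      by (simp only: pmf_return indicator_def singleton_iff eq[OF that])
  qed
qed

lemma joint_return: "joint q (\<lambda>x. return_pmf (f x)) = map_pmf (\<lambda>x. (x, f x)) q"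
  by (simp add: joint_def map_pmf_def bind_return_pmf)

text \<open>If no single observation increases the posterior expectation of \<open>h\<close>, then
  no adaptive run does. The induction splits off the first selection; the majorant \<open>B\<close>
  supplies all integrability.\<close>

lemma policy_run_supermartingale:
  fixes h :: "('e, 'o) partial_realization \<Rightarrow> ('e, 'o) realization \<Rightarrow> real"
  assumes E: "finite E" and \<pi>: "is_policy E q \<pi>"
    and B: "integrable (measure_pmf q) B"
    and bound: "\<And>\<phi> \<psi>. \<phi> \<in> set_pmf q \<Longrightarrow> dom \<psi> \<subseteq> E \<Longrightarrow> \<bar>h \<psi> \<phi>\<bar> \<le> B \<phi>"
    and step: "\<And>\<psi> e. \<psi> \<in> partial_realizations E q \<Longrightarrow> e \<in> E - dom \<psi> \<Longrightarrow>
        measure_pmf.expectation (posterior q \<psi>) (\<lambda>\<phi>. h (\<psi>(e \<mapsto> \<phi> e)) \<phi>) \<le>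
        measure_pmf.expectation (posterior q \<psi>) (h \<psi>)"
  shows "\<psi> \<in> partial_realizations E q \<Longrightarrow>
    measure_pmf.expectation (posterior q \<psi>)
      (\<lambda>\<phi>. measure_pmf.expectation (policy_run n \<pi> \<phi> \<psi>) (\<lambda>\<omega>. h \<omega> \<phi>)) \<le>
    measure_pmf.expectation (posterior q \<psi>) (h \<psi>)"
proof (induction n arbitrary: \<psi>)
  case (Suc n)
  let ?q = "posterior q \<psi>"
  let ?run = "\<lambda>\<phi> x. case x of None \<Rightarrow> return_pmf \<psi> | Some e \<Rightarrow> policy_run n \<pi> \<phi> (\<psi>(e \<mapsto> \<phi> e))"
  have dom: "dom \<psi> \<subseteq> E"
    using Suc.prems by (simp add: partial_realizations_iff)
  have Bq: "integrable (measure_pmf ?q) B"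
    using B Suc.prems by (rule integrable_posterior)
  have q: "\<phi> \<in> set_pmf q" "agrees \<phi> \<psi>" if "\<phi> \<in> set_pmf ?q" for \<phi>
    using that set_posterior[OF Suc.prems] by auto
  have next_item: "e \<in> E - dom \<psi>" if "Some e \<in> set_pmf (\<pi> \<psi>)" for e
    using \<pi> Suc.prems that by (fastforce simp: is_policy_def)
  have bound_run: "\<bar>h \<omega> \<phi>\<bar> \<le> B \<phi>"
    if "\<phi> \<in> set_pmf ?q" "\<omega> \<in> set_pmf (policy_run m \<pi> \<phi> \<psi>')" "agrees \<phi> \<psi>'" "dom \<psi>' \<subseteq> E" for \<phi> \<omega> m \<psi>'
    using bound policy_run_support[OF \<pi> q(1)[OF that(1)] that(3,4,2)] q(1)[OF that(1)] by blast
  have bound_step: "\<bar>measure_pmf.expectation (?run \<phi> x) (\<lambda>\<omega>. h \<omega> \<phi>)\<bar> \<le> B \<phi>"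
    if "\<phi> \<in> set_pmf ?q" "x \<in> set_pmf (\<pi> \<psi>)" for \<phi> x
  proof (rule abs_expectation_le)
    fix \<omega> assume "\<omega> \<in> set_pmf (?run \<phi> x)"
    then have "\<omega> \<in> set_pmf (policy_run (Suc n) \<pi> \<phi> \<psi>)"
      using that by auto
    then show "\<bar>h \<omega> \<phi>\<bar> \<le> B \<phi>"
      using bound_run[OF that(1)] q[OF that(1)] dom by blast
  qed
  have "measure_pmf.expectation ?q
        (\<lambda>\<phi>. measure_pmf.expectation (policy_run (Suc n) \<pi> \<phi> \<psi>) (\<lambda>\<omega>. h \<omega> \<phi>)) =
      measure_pmf.expectation ?q
        (\<lambda>\<phi>. measure_pmf.expectation (\<pi> \<psi>) (\<lambda>x. measure_pmf.expectation (?run \<phi> x) (\<lambda>\<omega>. h \<omega> \<phi>)))"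
  proof (rule integral_cong_pmf)
    fix \<phi> assume \<phi>: "\<phi> \<in> set_pmf ?q"
    have "integrable (measure_pmf (policy_run (Suc n) \<pi> \<phi> \<psi>)) (\<lambda>\<omega>. h \<omega> \<phi>)"
      by (rule integrable_bound_pmf[where B="\<lambda>_. B \<phi>"])
        (use bound_run[OF \<phi> _ q(2)[OF \<phi>] dom] in blast)+
    then show "measure_pmf.expectation (policy_run (Suc n) \<pi> \<phi> \<psi>) (\<lambda>\<omega>. h \<omega> \<phi>) =
        measure_pmf.expectation (\<pi> \<psi>) (\<lambda>x. measure_pmf.expectation (?run \<phi> x) (\<lambda>\<omega>. h \<omega> \<phi>))"
      unfolding policy_run.simps by (rule integral_bind_pmf_integrable)
  qed
  \<comment> \<open>The next action is drawn from a distribution depending on \<psi> only, so it is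
    independent of the realization given \<psi> and the two expectations commute.\<close>
  also have "\<dots> = measure_pmf.expectation (\<pi> \<psi>)
      (\<lambda>x. measure_pmf.expectation ?q (\<lambda>\<phi>. measure_pmf.expectation (?run \<phi> x) (\<lambda>\<omega>. h \<omega> \<phi>)))"
    by (rule integral_swap_pmf[OF Bq bound_step])
  also have "\<dots> \<le> measure_pmf.expectation (\<pi> \<psi>) (\<lambda>x. measure_pmf.expectation ?q (h \<psi>))"
  proof (rule integral_mono_pmf)
    have "set_pmf (\<pi> \<psi>) \<subseteq> insert None (Some ` (E - dom \<psi>))"
      using \<pi> Suc.prems unfolding is_policy_def by blast
    then have "finite (set_pmf (\<pi> \<psi>))"
      by (rule finite_subset) (use E in simp)
    then show "integrable (measure_pmf (\<pi> \<psi>))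
        (\<lambda>x. measure_pmf.expectation ?q (\<lambda>\<phi>. measure_pmf.expectation (?run \<phi> x) (\<lambda>\<omega>. h \<omega> \<phi>)))"
      by (rule integrable_measure_pmf_finite)
    show "measure_pmf.expectation ?q (\<lambda>\<phi>. measure_pmf.expectation (?run \<phi> x) (\<lambda>\<omega>. h \<omega> \<phi>)) \<le>
        measure_pmf.expectation ?q (h \<psi>)" if x: "x \<in> set_pmf (\<pi> \<psi>)" for x
    proof (cases x)
      case (Some e)
      let ?K = "\<lambda>\<phi>. return_pmf (\<psi>(e \<mapsto> \<phi> e))"
      let ?f = "\<lambda>(\<phi>, \<psi>'). measure_pmf.expectation (policy_run n \<pi> \<phi> \<psi>') (\<lambda>\<omega>. h \<omega> \<phi>)"
      have e: "e \<in> E - dom \<psi>"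
        using next_item x Some by simp
      have dom': "dom (\<psi>(e \<mapsto> s)) \<subseteq> E" for s
        using dom e by auto
      \<comment> \<open>Conditioning on the revealed state lets the induction hypothesis replace the
        rest of the run by \<open>h\<close> at the extended observation; \<open>step\<close> then
        removes that observation.\<close>
      have "measure_pmf.expectation (joint ?q ?K) ?f \<le>
          measure_pmf.expectation (joint ?q ?K) (\<lambda>(\<phi>, \<psi>'). h \<psi>' \<phi>)"
      proof (rule nonanticipating_integral_mono)
        show "nonanticipating ?q ?K"
          by (rule nonanticipating_observe) (rule q)
        show "integrable (measure_pmf (joint ?q ?K)) ?f"
        proof (rule integrable_joint[OF Bq])
          fix \<phi> \<psi>' assume \<phi>: "\<phi> \<in> set_pmf ?q" and "\<psi>' \<in> set_pmf (?K \<phi>)"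
          then have "\<psi>' = \<psi>(e \<mapsto> \<phi> e)"
            by simp
          then show "\<bar>?f (\<phi>, \<psi>')\<bar> \<le> B \<phi>"
            using abs_expectation_le[OF bound_run[OF \<phi> _ agrees_upd[OF q(2)[OF \<phi>]] dom']] by simp
        qed
        show "integrable (measure_pmf (joint ?q ?K)) (\<lambda>(\<phi>, \<psi>'). h \<psi>' \<phi>)"
          by (rule integrable_joint[OF Bq]) (use bound[OF q(1) dom'] in auto)
        fix \<phi> \<psi>' assume \<phi>: "\<phi> \<in> set_pmf ?q" and "\<psi>' \<in> set_pmf (?K \<phi>)"
        then have \<psi>': "\<psi>' = \<psi>(e \<mapsto> \<phi> e)"
          by simp
        have a: "agrees \<phi> \<psi>'"
          unfolding \<psi>' by (rule agrees_upd) (rule q(2)[OF \<phi>])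
        \<comment> \<open>Since \<open>\<psi>'\<close> extends \<psi>, conditioning on both is
          conditioning on \<open>\<psi>'\<close>.\<close>
        have "\<psi> ++ \<psi>' = \<psi>'"
          unfolding \<psi>' by (auto simp: map_add_def fun_eq_iff split: option.splits)
        then have post: "posterior ?q \<psi>' = posterior q \<psi>'"
          using posterior_posterior[OF q[OF \<phi>] a] by simp
        have "\<psi>' \<in> partial_realizations E q"
          using a q(1)[OF \<phi>] dom' by (auto simp: partial_realizations_iff \<psi>')
        from Suc.IH[OF this]
        show "measure_pmf.expectation (posterior ?q \<psi>') (\<lambda>\<phi>. ?f (\<phi>, \<psi>')) \<le>
            measure_pmf.expectation (posterior ?q \<psi>') (\<lambda>\<phi>. case (\<phi>, \<psi>') of (\<phi>, \<psi>') \<Rightarrow> h \<psi>' \<phi>)"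
          by (simp add: post)
      qed
      then show ?thesis
        using step[OF Suc.prems e] by (simp add: Some joint_return)
    qed simp
  qed simp
  finally show ?case by simp
qed simp

section \<open>Runs of the greedy policy\<close>

definition observe ::
    "('e, 'o) realization \<Rightarrow> ('e, 'o) partial_realization \<Rightarrow> 'e option \<Rightarrow> ('e, 'o) partial_realization" where
  "observe \<phi> \<psi> x = (case x of None \<Rightarrow> \<psi> | Some e \<Rightarrow> \<psi>(e \<mapsto> \<phi> e))"

lemma dom_observe: "dom (observe \<phi> \<psi> x) = dom \<psi> \<union> set_option x"
  by (auto simp: observe_def split: option.splits if_splits)

lemma agrees_observe: "agrees \<phi> \<psi> \<Longrightarrow> agrees \<phi> (observe \<phi> \<psi> x)"
  by (simp add: observe_def agrees_upd split: option.split)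

lemma map_le_observe: "agrees \<phi> \<psi> \<Longrightarrow> \<psi> \<subseteq>\<^sub>m observe \<phi> \<psi> x"
  by (simp add: observe_def map_le_upd_agrees split: option.split)

lemma observe_eq:
  assumes "agrees \<phi> \<omega>" "agrees \<phi>' \<omega>" "observe \<phi> \<psi> x = \<omega>"
  shows "observe \<phi>' \<psi> x = \<omega>"
proof (cases x)
  case (Some e)
  then have "e \<in> dom \<omega>"
    using assms(3) by (auto simp: observe_def)
  then show ?thesis
    using agrees_eq[OF assms(1,2)] assms(3) Some by (simp add: observe_def)
qed (use assms(3) in \<open>simp add: observe_def\<close>)

lemma greedy_run_Suc:
  "greedy_run r \<phi> (Suc i) = bind_pmf (greedy_run r \<phi> i) (\<lambda>\<psi>. map_pmf (observe \<phi> \<psi>) (r i \<psi>))"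
  by (simp add: observe_def[abs_def])

declare greedy_run.simps(2) [simp del]

lemma agrees_greedy_run: "\<psi> \<in> set_pmf (greedy_run r \<phi> i) \<Longrightarrow> agrees \<phi> \<psi>"
  by (induction i arbitrary: \<psi>) (auto simp: greedy_run_Suc agrees_observe)

text \<open>The last round is split off. A predecessor \<psi> contained in \<omega> inherits
  agreement with both realizations, and the last choice leads to \<omega> on one exactly if it does
  on the other. Any other \<psi> contributes zero: it is unreachable or cannot be extended to
  \<omega>.\<close>

lemma pmf_greedy_run_eq:
  "agrees \<phi> \<omega> \<Longrightarrow> agrees \<phi>' \<omega> \<Longrightarrow> pmf (greedy_run r \<phi> i) \<omega> = pmf (greedy_run r \<phi>' i) \<omega>"
proof (induction i arbitrary: \<omega>)
  case (Suc i)
  \<comment> \<open>The terms of the law of total probability over the observations \<psi> before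
    the last round, in \<open>ennreal\<close> so that they can be compared without summability
    conditions.\<close>
  let ?f = "\<lambda>\<phi> \<psi>. ennreal (pmf (greedy_run r \<phi> i) \<psi>) * ennreal (pmf (map_pmf (observe \<phi> \<psi>) (r i \<psi>)) \<omega>)"
  have "?f \<phi> \<psi> = ?f \<phi>' \<psi>" for \<psi>
  proof (cases "\<psi> \<subseteq>\<^sub>m \<omega>")
    case True
    then have "pmf (greedy_run r \<phi> i) \<psi> = pmf (greedy_run r \<phi>' i) \<psi>"
      using Suc agrees_map_le by blast
    moreover have "observe \<phi> \<psi> x = \<omega> \<longleftrightarrow> observe \<phi>' \<psi> x = \<omega>" for x
      using observe_eq[OF Suc.prems] observe_eq[OF Suc.prems(2,1)] by blast
    then have "observe \<phi> \<psi> -` {\<omega>} = observe \<phi>' \<psi> -` {\<omega>}"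
      by auto
    ultimately show ?thesis
      by (simp add: pmf_map)
  next
    case False
    have "?f \<theta> \<psi> = 0" for \<theta>
    proof (cases "agrees \<theta> \<psi>")
      case True
      then have "\<omega> \<notin> set_pmf (map_pmf (observe \<theta> \<psi>) (r i \<psi>))"
        using False map_le_observe[of \<theta> \<psi>] by auto
      then show ?thesis
        by (simp only: set_pmf_iff not_not) simp
    next
      case False
      then have "\<psi> \<notin> set_pmf (greedy_run r \<theta> i)"
        using agrees_greedy_run by blast
      then show ?thesis
        by (simp only: set_pmf_iff not_not) simp
    qed
    from this[of \<phi>] this[of \<phi>'] show ?thesis by (simp only:)
  qed
  then have "ennreal (pmf (greedy_run r \<phi> (Suc i)) \<omega>) = ennreal (pmf (greedy_run r \<phi>' (Suc i)) \<omega>)"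
    unfolding greedy_run_Suc ennreal_pmf_bind nn_integral_measure_pmf by simp
  then show ?case by simp
qed simp

lemma nonanticipating_greedy_run: "nonanticipating q (\<lambda>\<phi>. greedy_run r \<phi> i)"
  unfolding nonanticipating_def using agrees_greedy_run pmf_greedy_run_eq by blast

lemma joint_greedy_run_Suc:
  "joint q (\<lambda>\<phi>. greedy_run r \<phi> (Suc i)) =
     bind_pmf (joint q (\<lambda>\<phi>. greedy_run r \<phi> i)) (\<lambda>(\<phi>, \<psi>). map_pmf (\<lambda>x. (\<phi>, observe \<phi> \<psi> x)) (r i \<psi>))"
  by (simp add: joint_def greedy_run_Suc map_bind_pmf bind_assoc_pmf bind_map_pmf map_pmf_comp)

text \<open>Averages out the choice of the last round while the realization stays coupled to the
  earlier observations.\<close>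

lemma has_bochner_integral_greedy_run_Suc:
  fixes f :: "('e, 'o) realization \<times> ('e, 'o) partial_realization \<Rightarrow> real"
  assumes "integrable (measure_pmf (joint q (\<lambda>\<phi>. greedy_run r \<phi> (Suc i)))) f"
  shows "has_bochner_integral (measure_pmf (joint q (\<lambda>\<phi>. greedy_run r \<phi> i)))
    (\<lambda>(\<phi>, \<psi>). measure_pmf.expectation (r i \<psi>) (\<lambda>x. f (\<phi>, observe \<phi> \<psi> x)))
    (measure_pmf.expectation (joint q (\<lambda>\<phi>. greedy_run r \<phi> (Suc i))) f)"
  using has_bochner_integral_bind_pmf[OF assms[unfolded joint_greedy_run_Suc]]
  unfolding joint_greedy_run_Suc[symmetric] by (simp add: case_prod_unfold)

section \<open>Consequences of adaptive monotonicity and submodularity\<close>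

locale adaptive_revenue =
  fixes E :: "'e set" and p :: "('e, 'o) realization pmf"
    and g :: "'e set \<Rightarrow> ('e, 'o) realization \<Rightarrow> real"
  assumes finite_items: "finite E"
    and integrable_revenue: "Y \<subseteq> E \<Longrightarrow> integrable (measure_pmf p) (g Y)"
    and monotone: "adaptive_monotone E p g"
    and submodular: "adaptive_submodular E p g"
begin

text \<open>One integrable majorant for the revenue of every subset of \<open>E\<close>, and hence
  of any randomly selected set.\<close>

definition gsum :: "('e, 'o) realization \<Rightarrow> real" where
  "gsum \<phi> = (\<Sum>Y\<in>Pow E. \<bar>g Y \<phi>\<bar>)"

lemma integrable_gsum: "integrable (measure_pmf p) gsum"
  unfolding gsum_def[abs_def] using integrable_revenue by auto

lemma abs_revenue_le: "Y \<subseteq> E \<Longrightarrow> \<bar>g Y \<phi>\<bar> \<le> gsum \<phi>"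
  unfolding gsum_def by (rule member_le_sum) (auto simp: finite_items)

lemma expectation_marginal:
  assumes "\<psi> \<in> partial_realizations E p" "e \<in> E"
  shows "measure_pmf.expectation (posterior p \<psi>) (g (insert e (dom \<psi>))) =
    measure_pmf.expectation (posterior p \<psi>) (g (dom \<psi>)) + marginal p g e \<psi>"
proof -
  have "insert e (dom \<psi>) \<subseteq> E" "dom \<psi> \<subseteq> E"
    using assms by (auto simp: partial_realizations_iff)
  then have "integrable (measure_pmf (posterior p \<psi>)) (g (insert e (dom \<psi>)))"
    "integrable (measure_pmf (posterior p \<psi>)) (g (dom \<psi>))"
    using integrable_posterior[OF integrable_revenue assms(1)] by blast+
  then show ?thesis
    by (simp add: marginal_def)
qed

lemma marginal_mem: "e \<in> dom \<psi> \<Longrightarrow> marginal p g e \<psi> = 0"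
  by (simp add: marginal_def insert_absorb)

text \<open>Re-selecting an item has marginal zero, which extends the bound to all of
  \<open>E\<close>, as needed for greedy rounds that repeat an item.\<close>

lemma marginal_nonneg: "\<psi> \<in> partial_realizations E p \<Longrightarrow> e \<in> E \<Longrightarrow> marginal p g e \<psi> \<ge> 0"
  using monotone marginal_mem[of e \<psi>] by (cases "e \<in> dom \<psi>") (auto simp: adaptive_monotone_def)

text \<open>For an item already in \<open>\<psi>'\<close> the left side is zero and adaptive
  monotonicity at \<psi> suffices; otherwise this is adaptive submodularity.\<close>

lemma marginal_antimono:
  assumes "\<psi> \<in> partial_realizations E p" "\<psi>' \<in> partial_realizations E p" "\<psi> \<subseteq>\<^sub>m \<psi>'" "e \<in> E"
  shows "marginal p g e \<psi>' \<le> marginal p g e \<psi>"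
proof (cases "e \<in> dom \<psi>'")
  case True
  then show ?thesis
    using marginal_mem[OF True] marginal_nonneg[OF assms(1,4)] by simp
next
  case False
  then show ?thesis
    using submodular assms by (auto simp: adaptive_submodular_def)
qed

text \<open>Records only where the choices lie. That their distorted gain is maximal enters later,
  in \<open>greedy_gain_ge\<close>.\<close>

definition is_greedy_rule :: "nat \<Rightarrow> ('e, 'o) greedy_rule \<Rightarrow> bool" where
  "is_greedy_rule k r \<longleftrightarrow>
     (\<forall>i<k. \<forall>\<psi>\<in>partial_realizations E p. set_pmf (r i \<psi>) \<subseteq> insert None (Some ` E))"

lemma greedy_run_support:
  assumes r: "is_greedy_rule k r"
    and \<phi>: "\<phi> \<in> set_pmf p"
  shows "i \<le> k \<Longrightarrow> \<psi> \<in> set_pmf (greedy_run r \<phi> i) \<Longrightarrow> \<psi> \<in> partial_realizations E p"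
proof (induction i arbitrary: \<psi>)
  case 0
  then show ?case
    using \<phi> by (auto simp: partial_realizations_iff)
next
  case (Suc i)
  then obtain \<psi>' x where *: "\<psi>' \<in> set_pmf (greedy_run r \<phi> i)" "x \<in> set_pmf (r i \<psi>')"
      "\<psi> = observe \<phi> \<psi>' x"
    by (auto simp: greedy_run_Suc)
  then have "\<psi>' \<in> partial_realizations E p"
    using Suc by simp
  moreover from this have "x \<in> insert None (Some ` E)"
    using r *(2) Suc.prems(1) unfolding is_greedy_rule_def by (meson Suc_le_lessD subsetD)
  then have "set_option x \<subseteq> E"
    by auto
  ultimately have "dom \<psi> \<subseteq> E"
    by (auto simp: * dom_observe partial_realizations_iff)
  then show ?case
    using \<phi> agrees_greedy_run[OF Suc.prems(2)] by (auto simp: partial_realizations_iff)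
qed

text \<open>Here \<omega> is what another policy has observed. The greedy rule does not see
  \<omega>, but given both \<omega> and its own observations every further item has nonnegative
  marginal, so no round lowers the expected revenue of the union.\<close>

lemma greedy_run_revenue_ge:
  assumes r: "is_greedy_rule k r"
    and \<omega>: "\<omega> \<in> partial_realizations E p"
  shows "i \<le> k \<Longrightarrow> measure_pmf.expectation (posterior p \<omega>) (g (dom \<omega>)) \<le>
    measure_pmf.expectation (joint (posterior p \<omega>) (\<lambda>\<phi>. greedy_run r \<phi> i))
      (\<lambda>(\<phi>, \<psi>). g (dom \<omega> \<union> dom \<psi>) \<phi>)"
proof (induction i)
  case 0
  then show ?case by (simp add: joint_return)
next
  case (Suc i)
  let ?q = "posterior p \<omega>"
  let ?J = "\<lambda>i. joint ?q (\<lambda>\<phi>. greedy_run r \<phi> i)"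
  let ?f = "\<lambda>(\<phi>, \<psi>). g (dom \<omega> \<union> dom \<psi>) \<phi>"
  have q: "\<phi> \<in> set_pmf p" "agrees \<phi> \<omega>" if "\<phi> \<in> set_pmf ?q" for \<phi>
    using that set_posterior[OF \<omega>] by auto
  have dom_\<omega>: "dom \<omega> \<subseteq> E"
    using \<omega> by (simp add: partial_realizations_iff)
  have B: "integrable (measure_pmf ?q) gsum"
    using integrable_gsum \<omega> by (rule integrable_posterior)
  have int: "integrable (measure_pmf (?J j)) ?f" if "j \<le> k" for j
  proof (rule integrable_joint[OF B])
    fix \<phi> \<psi> assume \<phi>: "\<phi> \<in> set_pmf ?q" and "\<psi> \<in> set_pmf (greedy_run r \<phi> j)"
    then have "\<psi> \<in> partial_realizations E p"
      using greedy_run_support[OF r q(1)[OF \<phi>] that] by blast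
    then show "\<bar>?f (\<phi>, \<psi>)\<bar> \<le> gsum \<phi>"
      using dom_\<omega> by (auto simp: partial_realizations_iff intro!: abs_revenue_le)
  qed
  note step = has_bochner_integral_greedy_run_Suc[OF int[OF Suc.prems], simplified]
  have "measure_pmf.expectation ?q (g (dom \<omega>)) \<le> measure_pmf.expectation (?J i) ?f"
    using Suc by simp
  also have "\<dots> \<le> measure_pmf.expectation (?J i)
      (\<lambda>(\<phi>, \<psi>). measure_pmf.expectation (r i \<psi>) (\<lambda>x. g (dom \<omega> \<union> dom (observe \<phi> \<psi> x)) \<phi>))"
  proof (rule nonanticipating_integral_mono[OF nonanticipating_greedy_run])
    show "integrable (measure_pmf (?J i)) ?f"
      using int Suc.prems by simp
    show "integrable (measure_pmf (?J i))
      (\<lambda>(\<phi>, \<psi>). measure_pmf.expectation (r i \<psi>) (\<lambda>x. g (dom \<omega> \<union> dom (observe \<phi> \<psi> x)) \<phi>))"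
      using step by (simp add: has_bochner_integral_iff)
    fix \<phi>0 \<psi> assume \<phi>0: "\<phi>0 \<in> set_pmf ?q" and run: "\<psi> \<in> set_pmf (greedy_run r \<phi>0 i)"
    have \<psi>: "\<psi> \<in> partial_realizations E p"
      by (rule greedy_run_support[OF r q(1)[OF \<phi>0] _ run]) (use Suc.prems in simp)
    have a: "agrees \<phi>0 \<psi>"
      using run by (rule agrees_greedy_run)
    \<comment> \<open>Everything observed by both policies. In this order its domain simplifies to
      \<open>dom \<omega> \<union> dom \<psi>\<close>, the set in the statement.\<close>
    let ?\<psi> = "\<psi> ++ \<omega>"
    have post: "posterior ?q \<psi> = posterior p ?\<psi>"
      using posterior_posterior[OF q[OF \<phi>0] a] map_add_commute_agrees[OF q(2)[OF \<phi>0] a] by simp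
    have dom_add: "dom ?\<psi> = dom \<omega> \<union> dom \<psi>"
      by simp
    have "agrees \<phi>0 ?\<psi>"
      using agrees_map_add_iff[OF a q(2)[OF \<phi>0]] a q(2)[OF \<phi>0] by simp
    then have add: "?\<psi> \<in> partial_realizations E p"
      using \<psi> dom_\<omega> q(1)[OF \<phi>0] by (auto simp: partial_realizations_iff)
    have Bp: "integrable (measure_pmf (posterior p ?\<psi>)) gsum"
      using integrable_gsum add by (rule integrable_posterior)
    have rs: "set_pmf (r i \<psi>) \<subseteq> insert None (Some ` E)"
      using r \<psi> Suc.prems by (simp add: is_greedy_rule_def)
    then have finite_r: "finite (set_pmf (r i \<psi>))"
      by (rule finite_subset) (simp add: finite_items)
    have "measure_pmf.expectation (posterior p ?\<psi>) (g (dom ?\<psi>)) =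
        measure_pmf.expectation (r i \<psi>) (\<lambda>_. measure_pmf.expectation (posterior p ?\<psi>) (g (dom ?\<psi>)))"
      by simp
    also have "\<dots> \<le> measure_pmf.expectation (r i \<psi>)
        (\<lambda>x. measure_pmf.expectation (posterior p ?\<psi>) (g (dom ?\<psi> \<union> set_option x)))"
    proof (rule integral_mono_pmf)
      fix x assume "x \<in> set_pmf (r i \<psi>)"
      then show "measure_pmf.expectation (posterior p ?\<psi>) (g (dom ?\<psi>)) \<le>
          measure_pmf.expectation (posterior p ?\<psi>) (g (dom ?\<psi> \<union> set_option x))"
        using rs marginal_nonneg[OF add] expectation_marginal[OF add] by (cases x) (auto simp del: dom_map_add)
    qed (auto intro: integrable_measure_pmf_finite[OF finite_r])
    \<comment> \<open>The choice depends on \<psi> alone, which is fixed here, so it commutes with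
      the posterior expectation.\<close>
    also have "\<dots> = measure_pmf.expectation (posterior p ?\<psi>)
        (\<lambda>\<phi>. measure_pmf.expectation (r i \<psi>) (\<lambda>x. g (dom ?\<psi> \<union> set_option x) \<phi>))"
      by (rule integral_swap_pmf[OF Bp, symmetric])
        (use rs add in \<open>auto simp: partial_realizations_iff intro!: abs_revenue_le\<close>)
    finally show "measure_pmf.expectation (posterior ?q \<psi>) (\<lambda>\<phi>. ?f (\<phi>, \<psi>)) \<le>
        measure_pmf.expectation (posterior ?q \<psi>) (\<lambda>\<phi>. case (\<phi>, \<psi>) of (\<phi>, \<psi>) \<Rightarrow>
          measure_pmf.expectation (r i \<psi>) (\<lambda>x. g (dom \<omega> \<union> dom (observe \<phi> \<psi> x)) \<phi>))"
      by (simp only: post dom_add dom_observe prod.case Un_assoc)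
  qed
  also have "\<dots> = measure_pmf.expectation (?J (Suc i)) ?f"
    using step by (rule has_bochner_integral_integral_eq)
  finally show ?case .
qed

end

subsection \<open>The distorted greedy policy against an arbitrary policy\<close>

locale distorted_greedy = adaptive_revenue E p g
  for E :: "'e set" and p :: "('e, 'o) realization pmf"
    and g :: "'e set \<Rightarrow> ('e, 'o) realization \<Rightarrow> real" +
  fixes c :: "'e \<Rightarrow> real" and k :: nat
    and \<pi> :: "('e, 'o) policy" and r :: "('e, 'o) greedy_rule"
  assumes cost_nonneg: "e \<in> E \<Longrightarrow> c e \<ge> 0"
    and k_pos: "k \<ge> 1"
    and policy: "\<pi> \<in> policies_at_most E p k"
    and greedy: "is_distorted_greedy E p g c k r"
begin

lemma sum_cost_bounds: "Y \<subseteq> E \<Longrightarrow> 0 \<le> sum c Y" "Y \<subseteq> E \<Longrightarrow> sum c Y \<le> sum c E"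
  using cost_nonneg finite_items by (auto intro!: sum_nonneg sum_mono2)

lemma is_policy: "is_policy E p \<pi>"
  using policy by (simp add: policies_at_most_def)

lemma selected_support:
  assumes "\<phi> \<in> set_pmf p" "Y \<in> set_pmf (selected E \<pi> \<phi>)"
  shows "Y \<subseteq> E" "card Y \<le> k"
proof -
  show "card Y \<le> k"
    using policy assms unfolding policies_at_most_def by blast
  obtain \<xi> where "\<xi> \<in> set_pmf (policy_run (card E) \<pi> \<phi> Map.empty)" "Y = dom \<xi>"
    using assms(2) by (auto simp: selected_def)
  then show "Y \<subseteq> E"
    using policy_run_support[OF is_policy assms(1) agrees_empty] by auto
qed

lemma is_greedy_rule: "is_greedy_rule k r"
  using greedy by (auto simp: is_greedy_rule_def is_distorted_greedy_def is_arg_max_def)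

lemma abs_net_le:
  assumes "Y \<subseteq> E" "Z \<subseteq> E" "0 \<le> a"
  shows "\<bar>a * g Y \<phi> - sum c Z\<bar> \<le> a * gsum \<phi> + sum c E"
proof -
  have "\<bar>a * g Y \<phi>\<bar> \<le> a * gsum \<phi>"
    using abs_revenue_le[OF assms(1)] assms(3) by (simp add: abs_mult mult_left_mono)
  then show ?thesis
    using sum_cost_bounds[OF assms(2)] by linarith
qed

text \<open>Charging \<open>m\<close> for each selected item turns the distorted net revenue of the
  union into a supermartingale: after further observations an item's marginal is at most its
  marginal at \<psi>, so its distorted gain does not exceed the charge. The charges total at most
  \<open>k * m\<close>.\<close>

lemma policy_gain_le:
  assumes \<psi>: "\<psi> \<in> partial_realizations E p" and a: "0 \<le> a" and m: "0 \<le> m"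
    and gain: "\<And>e. e \<in> E \<Longrightarrow> a * marginal p g e \<psi> - c e \<le> m"
  shows "measure_pmf.expectation (posterior p \<psi>)
      (\<lambda>\<phi>. measure_pmf.expectation (selected E \<pi> \<phi>) (\<lambda>Y. a * g (dom \<psi> \<union> Y) \<phi> - sum c Y)) \<le>
    a * measure_pmf.expectation (posterior p \<psi>) (g (dom \<psi>)) + real k * m"
proof -
  let ?q = "posterior p \<psi>"
  let ?h = "\<lambda>Y \<phi>. a * g (dom \<psi> \<union> Y) \<phi> - sum c Y - m * real (card Y)"
  let ?B = "\<lambda>\<phi>. a * gsum \<phi> + sum c E + m * real (card E)"
  have q: "\<phi> \<in> set_pmf p" "agrees \<phi> \<psi>" if "\<phi> \<in> set_pmf ?q" for \<phi>
    using that set_posterior[OF \<psi>] by auto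
  have dom_\<psi>: "dom \<psi> \<subseteq> E"
    using \<psi> by (simp add: partial_realizations_iff)
  have gsum: "integrable (measure_pmf ?q) gsum"
    using integrable_gsum \<psi> by (rule integrable_posterior)
  then have B: "integrable (measure_pmf ?q) ?B"
    by simp
  have policy_q: "is_policy E ?q \<pi>"
    by (rule is_policy_mono[OF is_policy]) (use q in blast)
  have bound: "\<bar>?h Y \<phi>\<bar> \<le> ?B \<phi>" if "Y \<subseteq> E" for Y \<phi>
  proof -
    have "m * real (card Y) \<le> m * real (card E)"
      using that m finite_items by (intro mult_left_mono) (auto intro: card_mono)
    moreover have "0 \<le> m * real (card Y)"
      using m by simp
    moreover have "\<bar>a * g (dom \<psi> \<union> Y) \<phi> - sum c Y\<bar> \<le> a * gsum \<phi> + sum c E"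
      by (rule abs_net_le) (use that dom_\<psi> a in auto)
    ultimately show ?thesis by linarith
  qed
  have net: "\<bar>a * g (dom \<psi> \<union> Y) \<phi> - sum c Y\<bar> \<le> a * gsum \<phi> + sum c E"
    if "\<phi> \<in> set_pmf ?q" "Y \<in> set_pmf (selected E \<pi> \<phi>)" for \<phi> Y
    using selected_support(1)[OF q(1)[OF that(1)] that(2)] dom_\<psi> a by (intro abs_net_le) auto
  have pen: "\<bar>?h Y \<phi>\<bar> \<le> ?B \<phi>"
    if "\<phi> \<in> set_pmf ?q" "Y \<in> set_pmf (selected E \<pi> \<phi>)" for \<phi> Y
    using selected_support(1)[OF q(1)[OF that(1)] that(2)] by (rule bound)
  have pen_int: "integrable (measure_pmf ?q)
      (\<lambda>\<phi>. measure_pmf.expectation (selected E \<pi> \<phi>) (\<lambda>Y. ?h Y \<phi>))"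
    by (rule integrable_expectation[where f="\<lambda>\<phi> Y. ?h Y \<phi>", OF B pen])
  \<comment> \<open>The competing policy starts without observations and does not see \<psi>;
    knowledge of \<psi> enters only through the prior \<open>?q\<close>.\<close>
  have "measure_pmf.expectation (posterior ?q Map.empty)
      (\<lambda>\<phi>. measure_pmf.expectation (policy_run (card E) \<pi> \<phi> Map.empty) (\<lambda>\<xi>. ?h (dom \<xi>) \<phi>)) \<le>
    measure_pmf.expectation (posterior ?q Map.empty) 
      (?h (dom (Map.empty :: ('e, 'o) partial_realization)))"
  proof (rule policy_run_supermartingale[where h="\<lambda>\<xi>. ?h (dom \<xi>)", OF finite_items policy_q B])
    show "Map.empty \<in> partial_realizations E ?q"
      by (auto simp: partial_realizations_iff set_pmf_not_empty ex_in_conv)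
    show "\<bar>?h (dom \<xi>) \<phi>\<bar> \<le> ?B \<phi>" if "dom \<xi> \<subseteq> E" for \<xi> :: "('e, 'o) partial_realization" and \<phi>
      using that by (rule bound)
    fix \<xi> e assume \<xi>: "\<xi> \<in> partial_realizations E ?q" and e: "e \<in> E - dom \<xi>"
    then obtain \<phi>0 where \<phi>0: "\<phi>0 \<in> set_pmf ?q" and a\<xi>: "agrees \<phi>0 \<xi>" and dom_\<xi>: "dom \<xi> \<subseteq> E"
      by (auto simp: partial_realizations_iff)
    let ?\<psi> = "\<psi> ++ \<xi>"
    have post: "posterior ?q \<xi> = posterior p ?\<psi>"
      using posterior_posterior[OF q[OF \<phi>0] a\<xi>] .
    have add: "?\<psi> \<in> partial_realizations E p"
      using agrees_map_add_iff[OF q(2)[OF \<phi>0] a\<xi>] q[OF \<phi>0] a\<xi> dom_\<psi> dom_\<xi>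
      by (auto simp: partial_realizations_iff)
    have dom_add: "dom ?\<psi> = dom \<psi> \<union> dom \<xi>"
      by auto
    have "\<psi> \<subseteq>\<^sub>m ?\<psi>"
      using map_add_commute_agrees[OF q(2)[OF \<phi>0] a\<xi>] by simp
    \<comment> \<open>Adaptive submodularity compares \<psi> with \<psi> together with the
      competitor's observations.\<close>
    then have marg: "marginal p g e ?\<psi> \<le> marginal p g e \<psi>"
      using marginal_antimono[OF \<psi> add] e by blast
    have int: "integrable (measure_pmf (posterior p ?\<psi>)) (g Y)" if "Y \<subseteq> E" for Y
      using integrable_revenue[OF that] add by (rule integrable_posterior)
    have fin: "finite (dom \<xi>)"
      using dom_\<xi> finite_items finite_subset by blast
    have "a * marginal p g e ?\<psi> \<le> a * marginal p g e \<psi>"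
      using marg a by (rule mult_left_mono)
    then have le: "a * marginal p g e ?\<psi> - c e \<le> m"
      using gain[of e] e by simp
    have "measure_pmf.expectation (posterior ?q \<xi>) (\<lambda>\<phi>. ?h (dom (\<xi>(e \<mapsto> \<phi> e))) \<phi>) =
        measure_pmf.expectation (posterior p ?\<psi>)
          (\<lambda>\<phi>. a * g (insert e (dom ?\<psi>)) \<phi> - (c e + sum c (dom \<xi>) + m * (1 + real (card (dom \<xi>)))))"
      using e fin by (simp add: post Un_commute algebra_simps)
    also have "\<dots> = a * (measure_pmf.expectation (posterior p ?\<psi>) (g (dom ?\<psi>)) + marginal p g e ?\<psi>)
        - (c e + sum c (dom \<xi>) + m * (1 + real (card (dom \<xi>))))"
      using int[of "insert e (dom ?\<psi>)"] e dom_\<psi> dom_\<xi> expectation_marginal[OF add, of e] by simp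
    also have "\<dots> \<le> a * measure_pmf.expectation (posterior p ?\<psi>) (g (dom ?\<psi>))
        - sum c (dom \<xi>) - m * real (card (dom \<xi>))"
      using le by (simp add: algebra_simps)
    also have "\<dots> = measure_pmf.expectation (posterior ?q \<xi>) (?h (dom \<xi>))"
      using int[of "dom ?\<psi>"] dom_\<psi> dom_\<xi> by (simp add: post Un_commute)
    finally show "measure_pmf.expectation (posterior ?q \<xi>) (\<lambda>\<phi>. ?h (dom (\<xi>(e \<mapsto> \<phi> e))) \<phi>) \<le>
        measure_pmf.expectation (posterior ?q \<xi>) (?h (dom \<xi>))" .
  qed
  then have "measure_pmf.expectation ?q (\<lambda>\<phi>. measure_pmf.expectation (selected E \<pi> \<phi>) (\<lambda>Y. ?h Y \<phi>)) \<le>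
      a * measure_pmf.expectation ?q (g (dom \<psi>))"
    unfolding posterior_empty by (simp add: selected_def)
  \<comment> \<open>The charges are refunded: at most \<open>k\<close> items are selected and
    \<open>m\<close> is nonnegative.\<close>
  moreover have "measure_pmf.expectation ?q
      (\<lambda>\<phi>. measure_pmf.expectation (selected E \<pi> \<phi>) (\<lambda>Y. a * g (dom \<psi> \<union> Y) \<phi> - sum c Y)) \<le>
    measure_pmf.expectation ?q
      (\<lambda>\<phi>. measure_pmf.expectation (selected E \<pi> \<phi>) (\<lambda>Y. ?h Y \<phi>) + real k * m)"
  proof (rule integral_mono_pmf)
    show "integrable (measure_pmf ?q)
        (\<lambda>\<phi>. measure_pmf.expectation (selected E \<pi> \<phi>) (\<lambda>Y. a * g (dom \<psi> \<union> Y) \<phi> - sum c Y))"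
      by (rule integrable_expectation[OF _ net]) (use gsum in simp)
    show "integrable (measure_pmf ?q)
        (\<lambda>\<phi>. measure_pmf.expectation (selected E \<pi> \<phi>) (\<lambda>Y. ?h Y \<phi>) + real k * m)"
      using pen_int by simp
    fix \<phi> assume \<phi>: "\<phi> \<in> set_pmf ?q"
    have i: "integrable (measure_pmf (selected E \<pi> \<phi>)) (\<lambda>Y. ?h Y \<phi>)"
      by (rule integrable_bound_pmf[OF _ pen[OF \<phi>]]) auto
    have "measure_pmf.expectation (selected E \<pi> \<phi>) (\<lambda>Y. a * g (dom \<psi> \<union> Y) \<phi> - sum c Y) \<le>
        measure_pmf.expectation (selected E \<pi> \<phi>) (\<lambda>Y. ?h Y \<phi> + real k * m)"
    proof (rule integral_mono_pmf)
      show "integrable (measure_pmf (selected E \<pi> \<phi>)) (\<lambda>Y. a * g (dom \<psi> \<union> Y) \<phi> - sum c Y)"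
        by (rule integrable_bound_pmf[OF _ net[OF \<phi>]]) auto
      show "integrable (measure_pmf (selected E \<pi> \<phi>)) (\<lambda>Y. ?h Y \<phi> + real k * m)"
        using i by simp
      fix Y assume "Y \<in> set_pmf (selected E \<pi> \<phi>)"
      then have "m * real (card Y) \<le> m * real k"
        using selected_support(2)[OF q(1)[OF \<phi>]] m by (intro mult_left_mono) auto
      then show "a * g (dom \<psi> \<union> Y) \<phi> - sum c Y \<le> ?h Y \<phi> + real k * m"
        by (simp add: mult.commute)
    qed
    also have "\<dots> = measure_pmf.expectation (selected E \<pi> \<phi>) (\<lambda>Y. ?h Y \<phi>) + real k * m"
      using i by simp
    finally show "measure_pmf.expectation (selected E \<pi> \<phi>) (\<lambda>Y. a * g (dom \<psi> \<union> Y) \<phi> - sum c Y) \<le>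
        measure_pmf.expectation (selected E \<pi> \<phi>) (\<lambda>Y. ?h Y \<phi>) + real k * m" .
  qed
  ultimately show ?thesis
    using pen_int by simp
qed

text \<open>The witness \<open>m\<close> is the maximal distorted gain, attained by every choice in
  the support of the rule. It is nonnegative because the dummy item has gain zero.\<close>

lemma greedy_gain_ge:
  assumes \<psi>: "\<psi> \<in> partial_realizations E p" and i: "i < k"
    and a: "a = (1 - 1 / real k) ^ (k - (i + 1))"
  obtains m where "0 \<le> m" "\<And>e. e \<in> E \<Longrightarrow> a * marginal p g e \<psi> - c e \<le> m"
    "a * measure_pmf.expectation (posterior p \<psi>) (g (dom \<psi>)) - sum c (dom \<psi>) + m \<le>
      measure_pmf.expectation (posterior p \<psi>) (\<lambda>\<phi>. measure_pmf.expectation (r i \<psi>)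
        (\<lambda>x. a * g (dom \<psi> \<union> set_option x) \<phi> - sum c (dom \<psi> \<union> set_option x)))"
proof -
  let ?q = "posterior p \<psi>"
  let ?H = "distorted_gain p g c k i \<psi>"
  have a0: "0 \<le> a"
    using k_pos by (simp add: a)
  have dom_\<psi>: "dom \<psi> \<subseteq> E"
    using \<psi> by (simp add: partial_realizations_iff)
  have fin: "finite (dom \<psi>)"
    using dom_\<psi> finite_items finite_subset by blast
  have H: "?H None = 0" "?H (Some e) = a * marginal p g e \<psi> - c e" for e
    by (simp_all add: distorted_gain_def marginal_dummy_def cost_dummy_def a)
  have argmax: "is_arg_max ?H (\<lambda>y. y \<in> insert None (Some ` E)) x" if "x \<in> set_pmf (r i \<psi>)" for x
    using greedy \<psi> i that unfolding is_distorted_greedy_def by blast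
  then have rs: "x \<in> insert None (Some ` E)" if "x \<in> set_pmf (r i \<psi>)" for x
    using that unfolding is_arg_max_def by blast
  have max: "?H y \<le> ?H x" if "x \<in> set_pmf (r i \<psi>)" "y \<in> insert None (Some ` E)" for x y
    using argmax[OF that(1)] that(2) unfolding is_arg_max_def by (meson not_le)
  \<comment> \<open>Any possible choice serves to name the maximum, since ties have equal
    gain.\<close>
  obtain x0 where x0: "x0 \<in> set_pmf (r i \<psi>)"
    using set_pmf_not_empty[of "r i \<psi>"] by blast
  have gsum: "integrable (measure_pmf ?q) gsum"
    using integrable_gsum \<psi> by (rule integrable_posterior)
  have sub: "dom \<psi> \<union> set_option x \<subseteq> E" if "x \<in> set_pmf (r i \<psi>)" for x
    using rs[OF that] dom_\<psi> by auto
  let ?f = "\<lambda>x \<phi>. a * g (dom \<psi> \<union> set_option x) \<phi> - sum c (dom \<psi> \<union> set_option x)"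
  have "a * measure_pmf.expectation ?q (g (dom \<psi>)) - sum c (dom \<psi>) + ?H x0 =
      measure_pmf.expectation (r i \<psi>)
        (\<lambda>_. a * measure_pmf.expectation ?q (g (dom \<psi>)) - sum c (dom \<psi>) + ?H x0)"
    by simp
  also have "\<dots> \<le> measure_pmf.expectation (r i \<psi>) (\<lambda>x. measure_pmf.expectation ?q (?f x))"
  proof (rule integral_mono_pmf)
    have "finite (set_pmf (r i \<psi>))"
      by (rule finite_subset[of _ "insert None (Some ` E)"]) (use rs finite_items in auto)
    then show "integrable (measure_pmf (r i \<psi>)) (\<lambda>x. measure_pmf.expectation ?q (?f x))"
      by (rule integrable_measure_pmf_finite)
    fix x assume x: "x \<in> set_pmf (r i \<psi>)"
    have int: "integrable (measure_pmf ?q) (g (dom \<psi> \<union> set_option x))"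
      using integrable_revenue[OF sub[OF x]] \<psi> by (rule integrable_posterior)
    have "a * measure_pmf.expectation ?q (g (dom \<psi>)) - sum c (dom \<psi>) + ?H x0 \<le>
        a * measure_pmf.expectation ?q (g (dom \<psi>)) - sum c (dom \<psi>) + ?H x"
      using max[OF x rs[OF x0]] by simp
    also have "\<dots> \<le> a * measure_pmf.expectation ?q (g (dom \<psi> \<union> set_option x)) - sum c (dom \<psi> \<union> set_option x)"
    proof (cases x)
      case (Some e)
      then have e: "e \<in> E"
        using rs[OF x] by auto
      \<comment> \<open>Only an inequality: an item selected before is not paid for again.\<close>
      then have "sum c (insert e (dom \<psi>)) \<le> c e + sum c (dom \<psi>)"
        using fin cost_nonneg[OF e] by (simp add: sum.insert_if)
      then show ?thesis
        using expectation_marginal[OF \<psi> e] by (simp add: Some H algebra_simps)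
    qed (simp add: H)
    also have "\<dots> = measure_pmf.expectation ?q (?f x)"
      using int by simp
    finally show "a * measure_pmf.expectation ?q (g (dom \<psi>)) - sum c (dom \<psi>) + ?H x0 \<le>
        measure_pmf.expectation ?q (?f x)" .
  qed simp
  also have "\<dots> = measure_pmf.expectation ?q (\<lambda>\<phi>. measure_pmf.expectation (r i \<psi>) (\<lambda>x. ?f x \<phi>))"
  proof (rule integral_swap_pmf[symmetric])
    show "integrable (measure_pmf ?q) (\<lambda>\<phi>. a * gsum \<phi> + sum c E)"
      using gsum by simp
    show "\<bar>?f x \<phi>\<bar> \<le> a * gsum \<phi> + sum c E" if "x \<in> set_pmf (r i \<psi>)" for \<phi> x
      by (rule abs_net_le[OF sub[OF that] sub[OF that] a0])
  qed
  finally show ?thesis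
  proof (rule that[rotated 2])
    show "0 \<le> ?H x0"
      using max[OF x0, of None] H(1) by simp
    show "a * marginal p g e \<psi> - c e \<le> ?H x0" if "e \<in> E" for e
      using max[OF x0, of "Some e"] that H(2) by simp
  qed
qed

section \<open>Growth of the potential in one greedy round\<close>

abbreviation greedy_joint where "greedy_joint j \<equiv> joint p (\<lambda>\<phi>. greedy_run r \<phi> j)"

lemma greedy_partial:
  "\<phi> \<in> set_pmf p \<Longrightarrow> j \<le> k \<Longrightarrow> \<psi> \<in> set_pmf (greedy_run r \<phi> j) \<Longrightarrow> \<psi> \<in> partial_realizations E p"
  by (rule greedy_run_support[OF is_greedy_rule])

lemma greedy_dom:
  "\<phi> \<in> set_pmf p \<Longrightarrow> j \<le> k \<Longrightarrow> \<psi> \<in> set_pmf (greedy_run r \<phi> j) \<Longrightarrow> dom \<psi> \<subseteq> E"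
  using greedy_partial by (simp add: partial_realizations_iff)

lemma integrable_greedy_revenue:
  "j \<le> k \<Longrightarrow> integrable (measure_pmf (greedy_joint j)) (\<lambda>(\<phi>, \<psi>). g (dom \<psi>) \<phi>)"
  by (rule integrable_joint[OF integrable_gsum]) (simp add: abs_revenue_le greedy_dom)

lemma integrable_greedy_cost:
  "j \<le> k \<Longrightarrow> integrable (measure_pmf (greedy_joint j)) (\<lambda>(\<phi>, \<psi>). sum c (dom \<psi>))"
  by (rule integrable_joint[where B="\<lambda>_. sum c E"]) (use sum_cost_bounds greedy_dom in \<open>simp_all add: abs_le_iff\<close>)

lemma abs_selected_net_le:
  assumes "\<phi> \<in> set_pmf p" "Z \<subseteq> E" "0 \<le> a"
  shows "\<bar>measure_pmf.expectation (selected E \<pi> \<phi>) (\<lambda>Y. a * g (Z \<union> Y) \<phi> - sum c Y)\<bar>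
    \<le> a * gsum \<phi> + sum c E"
  using assms selected_support(1)[OF assms(1)] by (intro abs_expectation_le abs_net_le) auto

lemma integrable_selected_net:
  assumes "j \<le> k" "0 \<le> a"
  shows "integrable (measure_pmf (greedy_joint j)) (\<lambda>(\<phi>, \<psi>).
    measure_pmf.expectation (selected E \<pi> \<phi>) (\<lambda>Y. a * g (dom \<psi> \<union> Y) \<phi> - sum c Y))"
proof (rule integrable_joint)
  show "integrable (measure_pmf p) (\<lambda>\<phi>. a * gsum \<phi> + sum c E)"
    using integrable_gsum by simp
qed (use assms in \<open>simp add: abs_selected_net_le greedy_dom\<close>)

lemma g_avg_greedy:
  "j \<le> k \<Longrightarrow> g_avg p g (greedy_selected j r) =
    measure_pmf.expectation (greedy_joint j) (\<lambda>(\<phi>, \<psi>). g (dom \<psi>) \<phi>)"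
  using integral_joint[OF integrable_greedy_revenue] by (simp add: g_avg_def greedy_selected_def)

lemma c_avg_greedy:
  "j \<le> k \<Longrightarrow> c_avg p c (greedy_selected j r) =
    measure_pmf.expectation (greedy_joint j) (\<lambda>(\<phi>, \<psi>). sum c (dom \<psi>))"
  using integral_joint[OF integrable_greedy_cost] by (simp add: c_avg_def greedy_selected_def)

text \<open>Given the observations \<psi>, the competitor's distorted net revenue on the union is at
  most \<open>a\<close> times the current revenue plus \<open>k * m\<close>, by
  \<open>policy_gain_le\<close>. After division by \<open>k\<close> this amounts to the loss from
  the smaller coefficient \<open>a * (1 - 1 / real k)\<close> plus \<open>m\<close>, and the greedy
  round gains at least \<open>m\<close>.\<close>

lemma distorted_step:
  assumes i: "i < k" and a: "a = (1 - 1 / real k) ^ (k - (i + 1))"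
  shows "a * (1 - 1 / real k) * g_avg p g (greedy_selected i r) - c_avg p c (greedy_selected i r)
      + 1 / real k * measure_pmf.expectation (greedy_joint i) (\<lambda>(\<phi>, \<psi>).
          measure_pmf.expectation (selected E \<pi> \<phi>) (\<lambda>Y. a * g (dom \<psi> \<union> Y) \<phi> - sum c Y))
    \<le> a * g_avg p g (greedy_selected (Suc i) r) - c_avg p c (greedy_selected (Suc i) r)"
proof -
  have a0: "0 \<le> a"
    using k_pos by (simp add: a)
  let ?V = "\<lambda>(\<phi>, \<psi>). measure_pmf.expectation (selected E \<pi> \<phi>) (\<lambda>Y. a * g (dom \<psi> \<union> Y) \<phi> - sum c Y)"
  let ?f = "\<lambda>z. a * (case z of (\<phi>, \<psi>) \<Rightarrow> g (dom \<psi>) \<phi>) - (case z of (\<phi>, \<psi>) \<Rightarrow> sum c (dom \<psi>))"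
  let ?f1 = "\<lambda>z. a * (1 - 1 / real k) * (case z of (\<phi>, \<psi>) \<Rightarrow> g (dom \<psi>) \<phi>)
      - (case z of (\<phi>, \<psi>) \<Rightarrow> sum c (dom \<psi>)) + 1 / real k * ?V z"
  let ?f2 = "\<lambda>(\<phi>, \<psi>). measure_pmf.expectation (r i \<psi>) (\<lambda>x. ?f (\<phi>, observe \<phi> \<psi> x))"
  note ig = integrable_greedy_revenue and ic = integrable_greedy_cost
    and iV = integrable_selected_net[OF less_imp_le[OF i] a0]
  have f: "integrable (measure_pmf (greedy_joint (Suc i))) ?f"
    using ig[of "Suc i"] ic[of "Suc i"] i by simp
  note step = has_bochner_integral_greedy_run_Suc[OF f]
  have f1: "integrable (measure_pmf (greedy_joint i)) ?f1"
    using ig[of i] ic[of i] i iV by simp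
  have "measure_pmf.expectation (greedy_joint i) ?f1 \<le> measure_pmf.expectation (greedy_joint i) ?f2"
  proof (rule nonanticipating_integral_mono[OF nonanticipating_greedy_run f1])
    show "integrable (measure_pmf (greedy_joint i)) ?f2"
      using step by (simp only: has_bochner_integral_iff)
    fix \<phi>0 \<psi> assume "\<phi>0 \<in> set_pmf p" "\<psi> \<in> set_pmf (greedy_run r \<phi>0 i)"
    then have \<psi>: "\<psi> \<in> partial_realizations E p"
      using greedy_partial less_imp_le[OF i] by blast
    let ?q = "posterior p \<psi>"
    let ?R = "measure_pmf.expectation ?q (g (dom \<psi>))"
    have dom_\<psi>: "dom \<psi> \<subseteq> E"
      using \<psi> by (simp add: partial_realizations_iff)
    obtain m where m: "0 \<le> m" "\<And>e. e \<in> E \<Longrightarrow> a * marginal p g e \<psi> - c e \<le> m"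
      and ge: "a * ?R - sum c (dom \<psi>) + m \<le> measure_pmf.expectation ?q (\<lambda>\<phi>. measure_pmf.expectation (r i \<psi>)
        (\<lambda>x. a * g (dom \<psi> \<union> set_option x) \<phi> - sum c (dom \<psi> \<union> set_option x)))"
      using greedy_gain_ge[OF \<psi> i a] by blast
    have q: "\<phi> \<in> set_pmf p" if "\<phi> \<in> set_pmf ?q" for \<phi>
      using that set_posterior[OF \<psi>] by auto
    have int_V: "integrable (measure_pmf ?q) (\<lambda>\<phi>. ?V (\<phi>, \<psi>))"
    proof (rule integrable_bound_pmf)
      show "integrable (measure_pmf ?q) (\<lambda>\<phi>. a * gsum \<phi> + sum c E)"
        using integrable_posterior[OF integrable_gsum \<psi>] by simp
    qed (use q dom_\<psi> a0 in \<open>simp add: abs_selected_net_le\<close>)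
    have int_g: "integrable (measure_pmf ?q) (g (dom \<psi>))"
      using integrable_revenue[OF dom_\<psi>] \<psi> by (rule integrable_posterior)
    have "measure_pmf.expectation ?q (\<lambda>\<phi>. ?f1 (\<phi>, \<psi>)) =
        a * (1 - 1 / real k) * ?R - sum c (dom \<psi>) + 1 / real k * measure_pmf.expectation ?q (\<lambda>\<phi>. ?V (\<phi>, \<psi>))"
      using int_V int_g by simp
    also have "\<dots> \<le> a * (1 - 1 / real k) * ?R - sum c (dom \<psi>) + 1 / real k * (a * ?R + real k * m)"
      using policy_gain_le[OF \<psi> a0 m] by (intro add_left_mono mult_left_mono) auto
    \<comment> \<open>The share \<open>a * ?R / real k\<close> from the competitor's bound completes
      the coefficient to \<open>a\<close>.\<close>
    also have "\<dots> = a * ?R - sum c (dom \<psi>) + m"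
      using k_pos by (simp add: field_simps)
    also note ge
    finally show "measure_pmf.expectation ?q (\<lambda>\<phi>. ?f1 (\<phi>, \<psi>)) \<le>
        measure_pmf.expectation ?q (\<lambda>\<phi>. ?f2 (\<phi>, \<psi>))"
      by (simp only: prod.case dom_observe)
  qed
  also have "\<dots> = measure_pmf.expectation (greedy_joint (Suc i)) ?f"
    using step by (simp only: has_bochner_integral_iff)
  finally show ?thesis
    using ig[of i] ic[of i] ig[of "Suc i"] ic[of "Suc i"] i iV by (simp add: g_avg_greedy c_avg_greedy)
qed

section \<open>The competitor alone against its union with the greedy selection\<close>

abbreviation policy_joint where
  "policy_joint \<equiv> joint p (\<lambda>\<phi>. policy_run (card E) \<pi> \<phi> Map.empty)"

lemma policy_dom:
  "\<phi> \<in> set_pmf p \<Longrightarrow> \<omega> \<in> set_pmf (policy_run (card E) \<pi> \<phi> Map.empty) \<Longrightarrow> dom \<omega> \<subseteq> E"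
  using policy_run_support[OF is_policy _ agrees_empty] by simp

lemma integrable_policy_revenue:
  "integrable (measure_pmf policy_joint) (\<lambda>(\<phi>, \<omega>). g (dom \<omega>) \<phi>)"
  by (rule integrable_joint[OF integrable_gsum]) (simp add: abs_revenue_le policy_dom)

lemma integrable_policy_cost:
  "integrable (measure_pmf policy_joint) (\<lambda>(\<phi>, \<omega>). sum c (dom \<omega>))"
  by (rule integrable_joint[where B="\<lambda>_. sum c E"]) (use sum_cost_bounds policy_dom in \<open>simp_all add: abs_le_iff\<close>)

lemma g_avg_policy:
  "g_avg p g (selected E \<pi>) = measure_pmf.expectation policy_joint (\<lambda>(\<phi>, \<omega>). g (dom \<omega>) \<phi>)"
  using integral_joint[OF integrable_policy_revenue] by (simp add: g_avg_def selected_def)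

lemma c_avg_policy:
  "c_avg p c (selected E \<pi>) = measure_pmf.expectation policy_joint (\<lambda>(\<phi>, \<omega>). sum c (dom \<omega>))"
  using integral_joint[OF integrable_policy_cost] by (simp add: c_avg_def selected_def)

text \<open>The roles are exchanged: conditioning is on the competitor's observations \<omega>, and
  the greedy rounds come afterwards and do not lower the expected revenue. The cost is that of the
  competitor on both sides.\<close>

lemma policy_net_le:
  assumes i: "i \<le> k" and a: "0 \<le> a"
  shows "a * g_avg p g (selected E \<pi>) - c_avg p c (selected E \<pi>) \<le>
    measure_pmf.expectation (greedy_joint i) (\<lambda>(\<phi>, \<psi>).
      measure_pmf.expectation (selected E \<pi> \<phi>) (\<lambda>Y. a * g (dom \<psi> \<union> Y) \<phi> - sum c Y))"
proof -
  let ?B = "\<lambda>\<phi>. a * gsum \<phi> + sum c E"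
  let ?run = "\<lambda>\<phi>. policy_run (card E) \<pi> \<phi> Map.empty"
  let ?u = "\<lambda>\<phi> \<psi> \<omega>. a * g (dom \<omega> \<union> dom \<psi>) \<phi> - sum c (dom \<omega>)"
  let ?f1 = "\<lambda>z. a * (case z of (\<phi>, \<omega>) \<Rightarrow> g (dom \<omega>) \<phi>) - (case z of (\<phi>, \<omega>) \<Rightarrow> sum c (dom \<omega>))"
  let ?f2 = "\<lambda>(\<phi>, \<omega>). measure_pmf.expectation (greedy_run r \<phi> i) (\<lambda>\<psi>. ?u \<phi> \<psi> \<omega>)"
  have B: "integrable (measure_pmf p) ?B"
    using integrable_gsum by simp
  have u: "\<bar>?u \<phi> \<psi> \<omega>\<bar> \<le> ?B \<phi>"
    if "\<phi> \<in> set_pmf p" "\<psi> \<in> set_pmf (greedy_run r \<phi> i)" "dom \<omega> \<subseteq> E" for \<phi> \<psi> and \<omega> :: "('e, 'o) partial_realization"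
    using greedy_dom[OF that(1) i that(2)] that(3) a by (intro abs_net_le) auto
  have i1: "integrable (measure_pmf policy_joint) ?f1"
    using integrable_policy_revenue integrable_policy_cost by simp
  have i2: "integrable (measure_pmf policy_joint) ?f2"
  proof (rule integrable_joint[OF B])
    fix \<phi> \<omega> assume *: "\<phi> \<in> set_pmf p" "\<omega> \<in> set_pmf (?run \<phi>)"
    show "\<bar>?f2 (\<phi>, \<omega>)\<bar> \<le> ?B \<phi>"
      using abs_expectation_le[OF u[OF *(1) _ policy_dom[OF *]]] by simp
  qed
  have "a * g_avg p g (selected E \<pi>) - c_avg p c (selected E \<pi>) = measure_pmf.expectation policy_joint ?f1"
    using integrable_policy_revenue integrable_policy_cost by (simp add: g_avg_policy c_avg_policy)
  also have "\<dots> \<le> measure_pmf.expectation policy_joint ?f2"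
  proof (rule nonanticipating_integral_mono[OF nonanticipating_policy_run[OF is_policy] i1 i2])
    fix \<phi>0 \<omega> assume *: "\<phi>0 \<in> set_pmf p" "\<omega> \<in> set_pmf (?run \<phi>0)"
    then have \<omega>: "\<omega> \<in> partial_realizations E p"
      using policy_run_support[OF is_policy *(1) agrees_empty _ *(2)] by (auto simp: partial_realizations_iff)
    let ?q = "posterior p \<omega>"
    let ?J = "joint ?q (\<lambda>\<phi>. greedy_run r \<phi> i)"
    have q: "\<phi> \<in> set_pmf p" if "\<phi> \<in> set_pmf ?q" for \<phi>
      using that set_posterior[OF \<omega>] by auto
    have dom_\<omega>: "dom \<omega> \<subseteq> E"
      using \<omega> by (simp add: partial_realizations_iff)
    have int_g: "integrable (measure_pmf ?q) (g (dom \<omega>))"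
      using integrable_revenue[OF dom_\<omega>] \<omega> by (rule integrable_posterior)
    have int_J: "integrable (measure_pmf ?J) (\<lambda>(\<phi>, \<psi>). g (dom \<omega> \<union> dom \<psi>) \<phi>)"
    proof (rule integrable_joint[OF integrable_posterior[OF integrable_gsum \<omega>]])
      fix \<phi> \<psi> assume "\<phi> \<in> set_pmf ?q" "\<psi> \<in> set_pmf (greedy_run r \<phi> i)"
      then show "\<bar>case (\<phi>, \<psi>) of (\<phi>, \<psi>) \<Rightarrow> g (dom \<omega> \<union> dom \<psi>) \<phi>\<bar> \<le> gsum \<phi>"
        using greedy_dom[OF q i] dom_\<omega> by (simp add: abs_revenue_le)
    qed
    have net: "integrable (measure_pmf ?J) (\<lambda>(\<phi>, \<psi>). ?u \<phi> \<psi> \<omega>)"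
      using int_J by (simp add: case_prod_unfold)
    have "measure_pmf.expectation ?q (\<lambda>\<phi>. ?f1 (\<phi>, \<omega>)) =
        a * measure_pmf.expectation ?q (g (dom \<omega>)) - sum c (dom \<omega>)"
      using int_g by simp
    also have "\<dots> \<le> a * measure_pmf.expectation ?J (\<lambda>(\<phi>, \<psi>). g (dom \<omega> \<union> dom \<psi>) \<phi>) - sum c (dom \<omega>)"
      using greedy_run_revenue_ge[OF is_greedy_rule \<omega> i] a by (simp add: mult_left_mono)
    also have "\<dots> = measure_pmf.expectation ?J (\<lambda>(\<phi>, \<psi>). ?u \<phi> \<psi> \<omega>)"
      using int_J by (simp add: case_prod_unfold)
    also have "\<dots> = measure_pmf.expectation ?q (\<lambda>\<phi>. ?f2 (\<phi>, \<omega>))"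
      using integral_joint[OF net] by simp
    finally show "measure_pmf.expectation ?q (\<lambda>\<phi>. ?f1 (\<phi>, \<omega>)) \<le>
        measure_pmf.expectation ?q (\<lambda>\<phi>. ?f2 (\<phi>, \<omega>))" .
  qed
  also have "\<dots> = measure_pmf.expectation p
      (\<lambda>\<phi>. measure_pmf.expectation (?run \<phi>) (\<lambda>\<omega>. measure_pmf.expectation (greedy_run r \<phi> i) (\<lambda>\<psi>. ?u \<phi> \<psi> \<omega>)))"
    using integral_joint[OF i2] by simp
  \<comment> \<open>For a fixed realization the two runs use independent randomness, so their order
    is immaterial; this returns to the viewpoint of \<open>distorted_step\<close>.\<close>
  also have "\<dots> = measure_pmf.expectation p
      (\<lambda>\<phi>. measure_pmf.expectation (greedy_run r \<phi> i) (\<lambda>\<psi>. measure_pmf.expectation (?run \<phi>) (\<lambda>\<omega>. ?u \<phi> \<psi> \<omega>)))"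
  proof (rule integral_cong_pmf)
    fix \<phi> assume \<phi>: "\<phi> \<in> set_pmf p"
    show "measure_pmf.expectation (?run \<phi>) (\<lambda>\<omega>. measure_pmf.expectation (greedy_run r \<phi> i) (\<lambda>\<psi>. ?u \<phi> \<psi> \<omega>)) =
        measure_pmf.expectation (greedy_run r \<phi> i) (\<lambda>\<psi>. measure_pmf.expectation (?run \<phi>) (\<lambda>\<omega>. ?u \<phi> \<psi> \<omega>))"
      by (rule integral_swap_pmf[where B="\<lambda>_. ?B \<phi>"]) (simp, rule u[OF \<phi> _ policy_dom[OF \<phi>]])
  qed
  also have "\<dots> = measure_pmf.expectation (greedy_joint i) (\<lambda>(\<phi>, \<psi>).
      measure_pmf.expectation (selected E \<pi> \<phi>) (\<lambda>Y. a * g (dom \<psi> \<union> Y) \<phi> - sum c Y))"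
    using integral_joint[OF integrable_selected_net[OF i a]] by (simp add: selected_def Un_commute)
  finally show ?thesis .
qed

text \<open>With \<open>\<beta>\<^sub>j = (1 - 1/k)^(k-j)\<close> one has
  \<open>\<beta>\<^sub>j\<^sub>+\<^sub>1 / k = \<beta>\<^sub>j\<^sub>+\<^sub>1 -
  \<beta>\<^sub>j\<close>, so the revenue increments of the first \<open>i\<close> rounds telescope
  to \<open>\<beta>\<^sub>i - \<beta>\<^sub>0\<close>, while each round contributes a share 1/k of
  the cost.\<close>

lemma distorted_potential:
  assumes nonneg: "0 \<le> g_avg p g (greedy_selected 0 r)"
  shows "i \<le> k \<Longrightarrow>
    ((1 - 1 / real k) ^ (k - i) - (1 - 1 / real k) ^ k) * g_avg p g (selected E \<pi>)
      - real i / real k * c_avg p c (selected E \<pi>)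
    \<le> (1 - 1 / real k) ^ (k - i) * g_avg p g (greedy_selected i r) - c_avg p c (greedy_selected i r)"
proof (induction i)
  case 0
  have "c_avg p c (greedy_selected 0 r) = 0"
    by (simp add: c_avg_def greedy_selected_def)
  \<comment> \<open>Both coefficients on the left vanish, and what remains on the right is a
    nonnegative multiple of the expected revenue of the empty set.\<close>
  then show ?case
    using nonneg k_pos by simp
next
  case (Suc i)
  let ?t = "1 - 1 / real k"
  let ?a = "?t ^ (k - (i + 1))"
  let ?Go = "g_avg p g (selected E \<pi>)" and ?Co = "c_avg p c (selected E \<pi>)"
  have i: "i < k"
    using Suc.prems by simp
  have a0: "0 \<le> ?a"
    using k_pos by simp
  \<comment> \<open>This also covers \<open>k = 1\<close>, where \<open>?a\<close> is
    \<open>0 ^ 0 = 1\<close> and \<open>?t\<close> is 0.\<close>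
  have pow: "?t ^ (k - i) = ?a * ?t"
    using i by (simp add: Suc_diff_Suc flip: power_Suc2)
  have "(?a - ?t ^ k) * ?Go - real (Suc i) / real k * ?Co =
      (?t ^ (k - i) - ?t ^ k) * ?Go - real i / real k * ?Co + 1 / real k * (?a * ?Go - ?Co)"
    unfolding pow by (simp add: algebra_simps add_divide_distrib)
  also have "\<dots> \<le> ?t ^ (k - i) * g_avg p g (greedy_selected i r) - c_avg p c (greedy_selected i r)
      + 1 / real k * (?a * ?Go - ?Co)"
    using Suc by simp
  also have "\<dots> \<le> ?a * ?t * g_avg p g (greedy_selected i r) - c_avg p c (greedy_selected i r)
      + 1 / real k * measure_pmf.expectation (greedy_joint i) (\<lambda>(\<phi>, \<psi>).
          measure_pmf.expectation (selected E \<pi> \<phi>) (\<lambda>Y. ?a * g (dom \<psi> \<union> Y) \<phi> - sum c Y))"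
    unfolding pow using policy_net_le[OF less_imp_le[OF i] a0] by (intro add_left_mono mult_left_mono) auto
  also note distorted_step[OF i refl]
  finally show ?case by simp
qed

end

section \<open>From the factor 1 - (1 - 1/k)^k to 1 - 1/e\<close>

theorem theorem4p1:
  fixes E :: "'e set" and S :: "'o set"
    and p :: "('e, 'o) realization pmf"
    and g :: "'e set \<Rightarrow> ('e, 'o) realization \<Rightarrow> real"
    and c :: "'e \<Rightarrow> real"
    and k :: nat
    and \<pi>o :: "('e, 'o) policy"
    and \<pi>d :: "('e, 'o) greedy_rule"
  assumes "finite E"
    and "set_pmf p \<subseteq> E \<rightarrow>\<^sub>E S"
    and "\<And>Y \<phi>. Y \<subseteq> E \<Longrightarrow> \<phi> \<in> E \<rightarrow>\<^sub>E S \<Longrightarrow> g Y \<phi> \<ge> 0"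
    and "\<And>Y. Y \<subseteq> E \<Longrightarrow> integrable (measure_pmf p) (g Y)"
    and "adaptive_monotone E p g"
    and "adaptive_submodular E p g"
    and "\<And>e. e \<in> E \<Longrightarrow> c e \<ge> 0"
    and "k \<ge> 1"
    and "is_arg_max (\<lambda>\<pi>. g_avg p g (selected E \<pi>) - c_avg p c (selected E \<pi>))
           (\<lambda>\<pi>. \<pi> \<in> policies_at_most E p k) \<pi>o"
    and "is_distorted_greedy E p g c k \<pi>d"
  shows "g_avg p g (greedy_selected k \<pi>d) - c_avg p c (greedy_selected k \<pi>d)
           \<ge> (1 - 1 / exp 1) * g_avg p g (selected E \<pi>o) - c_avg p c (selected E \<pi>o)"
proof -
  interpret distorted_greedy E p g c k \<pi>o \<pi>d
    using assms by unfold_locales (auto simp: is_arg_max_def)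
  \<comment> \<open>Nonnegativity of \<open>g\<close> is given on
    \<open>E \<rightarrow>\<^sub>E S\<close> only, which contains the support of the prior.\<close>
  have nonneg: "0 \<le> g_avg p g sel"
    if "\<And>\<phi> Y. \<phi> \<in> set_pmf p \<Longrightarrow> Y \<in> set_pmf (sel \<phi>) \<Longrightarrow> Y \<subseteq> E" for sel
  proof -
    have "0 \<le> g Y \<phi>" if "\<phi> \<in> set_pmf p" "Y \<in> set_pmf (sel \<phi>)" for \<phi> Y
      using assms(2,3) that \<open>\<And>\<phi> Y. \<phi> \<in> set_pmf p \<Longrightarrow> Y \<in> set_pmf (sel \<phi>) \<Longrightarrow> Y \<subseteq> E\<close> by blast
    then show ?thesis
      unfolding g_avg_def by (intro integral_nonneg_AE AE_pmfI) auto
  qed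
  have "(1 - 1 / real k) ^ k \<le> exp (- 1)"
    using exp_ge_one_minus_x_over_n_power_n[of 1 k] assms(8) by simp
  \<comment> \<open>Passing to the smaller factor 1 - 1/e weakens the bound because the revenue of
    the optimal policy is nonnegative.\<close>
  then have "(1 - 1 / exp 1) * g_avg p g (selected E \<pi>o) \<le>
      (1 - (1 - 1 / real k) ^ k) * g_avg p g (selected E \<pi>o)"
    using nonneg[of "selected E \<pi>o"] selected_support(1)
    by (intro mult_right_mono) (auto simp: exp_minus inverse_eq_divide)
  moreover have "0 \<le> g_avg p g (greedy_selected 0 \<pi>d)"
    by (rule nonneg) (auto simp: greedy_selected_def)
  \<comment> \<open>After all \<open>k\<close> rounds the distortion exponent is 0, so the potential
    is the undistorted net revenue.\<close>
  from distorted_potential[OF this order_refl]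
  have "(1 - (1 - 1 / real k) ^ k) * g_avg p g (selected E \<pi>o) - c_avg p c (selected E \<pi>o) \<le>
      g_avg p g (greedy_selected k \<pi>d) - c_avg p c (greedy_selected k \<pi>d)"
    using assms(8) by simp
  ultimately show ?thesis by linarith
qed

end
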